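(* Let $(H,R)$ be a quasi-triangular Hopf algebra over a field $k$, and regard $H$ as the Yetter-Drinfeld module $(H,\cdot_{ad},\Delta)\in{}_H^H\mathcal{YD}$. For any Yetter-Drinfeld submodule $D$ of $H$, $D$ is a subcoalgebra of $H_R$. Moreover, $D$ is a minimal Yetter-Drinfeld submodule of $H$ if and only if $D$ is a minimal $H$-adjoint-stable subcoalgebra of $H_R$ with respect to the left adjoint action $\cdot_{ad}$.
   Context: $H$ has coproduct $\Delta(h)=\sum h_{(1)}\otimes h_{(2)}$, counit $\varepsilon$ and antipode $S$. Quasi-triangular: $R=\sum R^1\otimes R^2\in H\otimes H$ is invertible with $\sum R^1h_{(1)}\otimes R^2h_{(2)}=\sum h_{(2)}R^1\otimes h_{(1)}R^2$ for all $h\in H$, $(\Delta\otimes id)(R)=R^{13}R^{23}$, $(id\otimes\Delta)(R)=R^{13}R^{12}$. Left adjoint action: $h\cdot_{ad}a=\sum h_{(1)}aS(h_{(2)})$. Transmuted braided group $H_R$: the vector space $H$ with the action $\cdot_{ad}$ and the (coassociative) coproduct $\Delta_R(h)=\sum h_{(1)}S(R^2)\otimes R^1\cdot_{ad}h_{(2)}$ and counit $\varepsilon$. $H$-adjoint-stable means stable under $\cdot_{ad}$; minimal means nonzero and minimal under inclusion among nonzero objects of the stated kind. ${}_H^H\mathcal{YD}$ is the category of left-left Yetter-Drinfeld modules: left $H$-modules and left $H$-comodules $V$ with $\sum(hv)_{\langle-1\rangle}\otimes(hv)_{\langle0\rangle}=\sum h_{(1)}v_{\langle-1\rangle}S(h_{(3)})\otimes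 h_{(2)}v_{\langle0\rangle}$. *)

theory Defs
  imports Complex_Main
begin

text \<open>
  Throughout, the vector space with underlying additive group the type \<open>'v\<close> is given by its
  scalar multiplication \<open>s :: 'k \<Rightarrow> 'v \<Rightarrow> 'v\<close>.

  A list \<open>[(a\<^sub>1, b\<^sub>1), \<dots>, (a\<^sub>n, b\<^sub>n)]\<close> stands for the element
  \<open>a\<^sub>1 \<otimes> b\<^sub>1 + \<dots> + a\<^sub>n \<otimes> b\<^sub>n\<close> of the tensor product, and a list of triples likewise for an
  element of a triple tensor product; addition is \<open>@\<close>. Two lists denote the same tensor iff they
  are related by the congruence \<open>tensor2\<close> (\<open>tensor3\<close>), i.e. the tensor product is the free
  commutative monoid on pairs (triples) modulo the usual relations. The quotient is a group since
  \<open>a \<otimes> b + (-a) \<otimes> b = 0 \<otimes> b = 0\<close>. A map into a tensor product is given by a choice of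
  representatives, and identities between tensors are always stated modulo the congruence.
  List comprehensions then read exactly as Sweedler notation.
\<close>

inductive sum_cong :: "('x list \<Rightarrow> 'x list \<Rightarrow> bool) \<Rightarrow> 'x list \<Rightarrow> 'x list \<Rightarrow> bool"
  for G :: "'x list \<Rightarrow> 'x list \<Rightarrow> bool" where
  gen: "G xs ys \<Longrightarrow> sum_cong G xs ys"
| refl: "sum_cong G xs xs"
| sym: "sum_cong G xs ys \<Longrightarrow> sum_cong G ys xs"
| trans: "sum_cong G xs ys \<Longrightarrow> sum_cong G ys zs \<Longrightarrow> sum_cong G xs zs"
| comm: "sum_cong G (xs @ ys) (ys @ xs)"
| add: "sum_cong G xs ys \<Longrightarrow> sum_cong G xs' ys' \<Longrightarrow> sum_cong G (xs @ xs') (ys @ ys')"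

inductive tensor2_rel ::
  "('k::field \<Rightarrow> 'a::ab_group_add \<Rightarrow> 'a) \<Rightarrow> ('k \<Rightarrow> 'b::ab_group_add \<Rightarrow> 'b) \<Rightarrow>
   ('a \<times> 'b) list \<Rightarrow> ('a \<times> 'b) list \<Rightarrow> bool"
  for s t where
  "tensor2_rel s t [(0, b)] []"
| "tensor2_rel s t [(a, 0)] []"
| "tensor2_rel s t [(a + a', b)] [(a, b), (a', b)]"
| "tensor2_rel s t [(a, b + b')] [(a, b), (a, b')]"
| "tensor2_rel s t [(s r a, b)] [(a, t r b)]"

inductive tensor3_rel ::
  "('k::field \<Rightarrow> 'a::ab_group_add \<Rightarrow> 'a) \<Rightarrow> ('k \<Rightarrow> 'b::ab_group_add \<Rightarrow> 'b) \<Rightarrow>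
   ('k \<Rightarrow> 'c::ab_group_add \<Rightarrow> 'c) \<Rightarrow> ('a \<times> 'b \<times> 'c) list \<Rightarrow> ('a \<times> 'b \<times> 'c) list \<Rightarrow> bool"
  for s t u where
  "tensor3_rel s t u [(0, b, c)] []"
| "tensor3_rel s t u [(a, 0, c)] []"
| "tensor3_rel s t u [(a, b, 0)] []"
| "tensor3_rel s t u [(a + a', b, c)] [(a, b, c), (a', b, c)]"
| "tensor3_rel s t u [(a, b + b', c)] [(a, b, c), (a, b', c)]"
| "tensor3_rel s t u [(a, b, c + c')] [(a, b, c), (a, b, c')]"
| "tensor3_rel s t u [(s r a, b, c)] [(a, t r b, c)]"
| "tensor3_rel s t u [(a, t r b, c)] [(a, b, u r c)]"

definition tensor2 ::
  "('k::field \<Rightarrow> 'a::ab_group_add \<Rightarrow> 'a) \<Rightarrow> ('k \<Rightarrow> 'b::ab_group_add \<Rightarrow> 'b) \<Rightarrow>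
   ('a \<times> 'b) list \<Rightarrow> ('a \<times> 'b) list \<Rightarrow> bool" where
  "tensor2 s t = sum_cong (tensor2_rel s t)"

definition tensor3 ::
  "('k::field \<Rightarrow> 'a::ab_group_add \<Rightarrow> 'a) \<Rightarrow> ('k \<Rightarrow> 'b::ab_group_add \<Rightarrow> 'b) \<Rightarrow>
   ('k \<Rightarrow> 'c::ab_group_add \<Rightarrow> 'c) \<Rightarrow> ('a \<times> 'b \<times> 'c) list \<Rightarrow> ('a \<times> 'b \<times> 'c) list \<Rightarrow> bool" where
  "tensor3 s t u = sum_cong (tensor3_rel s t u)"

text \<open>
  \<open>in_tensor s t A B xs\<close>: the tensor denoted by \<open>xs\<close> lies in \<open>A \<otimes> B\<close>, for subspaces \<open>A\<close> and \<open>B\<close>.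
\<close>

definition in_tensor ::
  "('k::field \<Rightarrow> 'a::ab_group_add \<Rightarrow> 'a) \<Rightarrow> ('k \<Rightarrow> 'b::ab_group_add \<Rightarrow> 'b) \<Rightarrow>
   'a set \<Rightarrow> 'b set \<Rightarrow> ('a \<times> 'b) list \<Rightarrow> bool" where
  "in_tensor s t A B xs \<longleftrightarrow> (\<exists>ys. set ys \<subseteq> A \<times> B \<and> tensor2 s t xs ys)"

text \<open>
  The underlying space of \<open>H\<close> is all of the type \<open>'h\<close>. The requirement \<open>0 \<noteq> 1\<close> of \<open>ring_1\<close> is
  automatic for a Hopf algebra, because \<open>\<epsilon> 1 = 1\<close>.
\<close>

locale hopf_algebra = vector_space s
  for s :: "'k::field \<Rightarrow> 'h::ring_1 \<Rightarrow> 'h" +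
  fixes \<Delta> :: "'h \<Rightarrow> ('h \<times> 'h) list"
    and \<epsilon> :: "'h \<Rightarrow> 'k"
    and S :: "'h \<Rightarrow> 'h"
  assumes scale_mult_left: "s r a * b = s r (a * b)"
    and scale_mult_right: "a * s r b = s r (a * b)"
    and comult_add: "tensor2 s s (\<Delta> (a + b)) (\<Delta> a @ \<Delta> b)"
    and comult_scale: "tensor2 s s (\<Delta> (s r a)) [(s r x, y). (x, y) \<leftarrow> \<Delta> a]"
    and counit_linear: "Vector_Spaces.linear s (*) \<epsilon>"
    and coassoc: "tensor3 s s s
          [(x1, x2, y). (x, y) \<leftarrow> \<Delta> a, (x1, x2) \<leftarrow> \<Delta> x]
          [(x, y1, y2). (x, y) \<leftarrow> \<Delta> a, (y1, y2) \<leftarrow> \<Delta> y]"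
    and counit_left: "(\<Sum>(x, y) \<leftarrow> \<Delta> a. s (\<epsilon> x) y) = a"
    and counit_right: "(\<Sum>(x, y) \<leftarrow> \<Delta> a. s (\<epsilon> y) x) = a"
    and comult_mult: "tensor2 s s (\<Delta> (a * b))
          [(x * x', y * y'). (x, y) \<leftarrow> \<Delta> a, (x', y') \<leftarrow> \<Delta> b]"
    and comult_one: "tensor2 s s (\<Delta> 1) [(1, 1)]"
    and counit_mult: "\<epsilon> (a * b) = \<epsilon> a * \<epsilon> b"
    and counit_one: "\<epsilon> 1 = 1"
    and antipode_linear: "Vector_Spaces.linear s s S"
    and antipode_left: "(\<Sum>(x, y) \<leftarrow> \<Delta> a. S x * y) = s (\<epsilon> a) 1"
    and antipode_right: "(\<Sum>(x, y) \<leftarrow> \<Delta> a. x * S y) = s (\<epsilon> a) 1"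

locale quasitriangular_hopf_algebra = hopf_algebra s \<Delta> \<epsilon> S
  for s :: "'k::field \<Rightarrow> 'h::ring_1 \<Rightarrow> 'h"
    and \<Delta> :: "'h \<Rightarrow> ('h \<times> 'h) list"
    and \<epsilon> :: "'h \<Rightarrow> 'k"
    and S :: "'h \<Rightarrow> 'h" +
  fixes R :: "('h \<times> 'h) list"
  assumes R_invertible: "\<exists>Q.
          tensor2 s s [(r1 * q1, r2 * q2). (r1, r2) \<leftarrow> R, (q1, q2) \<leftarrow> Q] [(1, 1)] \<and>
          tensor2 s s [(q1 * r1, q2 * r2). (q1, q2) \<leftarrow> Q, (r1, r2) \<leftarrow> R] [(1, 1)]"
    and R_comult: "tensor2 s s
          [(r1 * h1, r2 * h2). (r1, r2) \<leftarrow> R, (h1, h2) \<leftarrow> \<Delta> h]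
          [(h2 * r1, h1 * r2). (r1, r2) \<leftarrow> R, (h1, h2) \<leftarrow> \<Delta> h]"
    \<comment> \<open>\<open>(\<Delta> \<otimes> id) R = R\<^sup>1\<^sup>3 R\<^sup>2\<^sup>3\<close> and \<open>(id \<otimes> \<Delta>) R = R\<^sup>1\<^sup>3 R\<^sup>1\<^sup>2\<close>\<close>
    and comult_id_R: "tensor3 s s s
          [(x, y, r2). (r1, r2) \<leftarrow> R, (x, y) \<leftarrow> \<Delta> r1]
          [(r1, r1', r2 * r2'). (r1, r2) \<leftarrow> R, (r1', r2') \<leftarrow> R]"
    and id_comult_R: "tensor3 s s s
          [(r1, x, y). (r1, r2) \<leftarrow> R, (x, y) \<leftarrow> \<Delta> r2]
          [(r1 * r1', r2', r2). (r1, r2) \<leftarrow> R, (r1', r2') \<leftarrow> R]"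

definition adjoint :: "('h \<Rightarrow> ('h \<times> 'h) list) \<Rightarrow> ('h \<Rightarrow> 'h) \<Rightarrow> 'h::ring_1 \<Rightarrow> 'h \<Rightarrow> 'h" where
  "adjoint \<Delta> S h a = (\<Sum>(h1, h2) \<leftarrow> \<Delta> h. h1 * a * S h2)"

definition transmuted_comult ::
  "('h \<Rightarrow> ('h \<times> 'h) list) \<Rightarrow> ('h \<Rightarrow> 'h) \<Rightarrow> ('h \<times> 'h) list \<Rightarrow> 'h::ring_1 \<Rightarrow> ('h \<times> 'h) list" where
  "transmuted_comult \<Delta> S R h =
     [(h1 * S r2, adjoint \<Delta> S r1 h2). (h1, h2) \<leftarrow> \<Delta> h, (r1, r2) \<leftarrow> R]"

locale yetter_drinfeld_module = hopf_algebra s \<Delta> \<epsilon> S + V: vector_space t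
  for s :: "'k::field \<Rightarrow> 'h::ring_1 \<Rightarrow> 'h"
    and \<Delta> :: "'h \<Rightarrow> ('h \<times> 'h) list"
    and \<epsilon> :: "'h \<Rightarrow> 'k"
    and S :: "'h \<Rightarrow> 'h"
    and t :: "'k \<Rightarrow> 'v::ab_group_add \<Rightarrow> 'v" +
  fixes act :: "'h \<Rightarrow> 'v \<Rightarrow> 'v"
    and coact :: "'v \<Rightarrow> ('h \<times> 'v) list"
  assumes act_add_left: "act (g + h) v = act g v + act h v"
    and act_add_right: "act h (v + w) = act h v + act h w"
    and act_scale_left: "act (s r h) v = t r (act h v)"
    and act_scale_right: "act h (t r v) = t r (act h v)"
    and act_mult: "act (g * h) v = act g (act h v)"
    and act_one: "act 1 v = v"
    and coact_add: "tensor2 s t (coact (v + w)) (coact v @ coact w)"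
    and coact_scale: "tensor2 s t (coact (t r v)) [(s r x, w). (x, w) \<leftarrow> coact v]"
    and coact_coassoc: "tensor3 s s t
          [(x1, x2, w). (x, w) \<leftarrow> coact v, (x1, x2) \<leftarrow> \<Delta> x]
          [(x, y, u). (x, w) \<leftarrow> coact v, (y, u) \<leftarrow> coact w]"
    and coact_counit: "(\<Sum>(x, w) \<leftarrow> coact v. t (\<epsilon> x) w) = v"
    and compatibility: "tensor2 s t (coact (act h v))
          [(h1 * x * S h3, act h2 w).
             (h12, h3) \<leftarrow> \<Delta> h, (h1, h2) \<leftarrow> \<Delta> h12, (x, w) \<leftarrow> coact v]"

definition action_stable :: "('h \<Rightarrow> 'v \<Rightarrow> 'v) \<Rightarrow> 'v set \<Rightarrow> bool" where
  "action_stable act W \<longleftrightarrow> (\<forall>h. \<forall>w\<in>W. act h w \<in> W)"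

definition yd_submodule ::
  "('k::field \<Rightarrow> 'h::ring_1 \<Rightarrow> 'h) \<Rightarrow> ('k \<Rightarrow> 'v::ab_group_add \<Rightarrow> 'v) \<Rightarrow>
   ('h \<Rightarrow> 'v \<Rightarrow> 'v) \<Rightarrow> ('v \<Rightarrow> ('h \<times> 'v) list) \<Rightarrow> 'v set \<Rightarrow> bool" where
  "yd_submodule s t act coact W \<longleftrightarrow>
     module.subspace t W \<and> action_stable act W \<and> (\<forall>w\<in>W. in_tensor s t UNIV W (coact w))"

definition subcoalgebra ::
  "('k::field \<Rightarrow> 'c::ab_group_add \<Rightarrow> 'c) \<Rightarrow> ('c \<Rightarrow> ('c \<times> 'c) list) \<Rightarrow> 'c set \<Rightarrow> bool" where
  "subcoalgebra s \<Delta> D \<longleftrightarrow> module.subspace s D \<and> (\<forall>d\<in>D. in_tensor s s D D (\<Delta> d))"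

definition minimal_nonzero :: "('v::zero set \<Rightarrow> bool) \<Rightarrow> 'v set \<Rightarrow> bool" where
  "minimal_nonzero P D \<longleftrightarrow>
     P D \<and> D \<noteq> {0} \<and> (\<forall>E. P E \<and> E \<noteq> {0} \<and> E \<subseteq> D \<longrightarrow> E = D)"

end

theory Submission
  imports Defs
begin

text \<open>
  The two classes of subspaces in the statement are the same, so that their minimal nonzero members
  are the same too. Writing \<open>R = R\<^sup>1 \<otimes> R\<^sup>2\<close> and \<open>\<cdot>\<close> for the adjoint action, the transmuted coproduct
  is \<open>\<Delta>\<^sub>R(h) = h\<^sub>1 S(R\<^sup>2) \<otimes> R\<^sup>1 \<cdot> h\<^sub>2\<close>.

  Let \<open>D\<close> be a Yetter-Drinfeld submodule, so that \<open>\<Delta>(D) \<subseteq> H \<otimes> D\<close> and \<open>D\<close> is stable. The formula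
  above gives \<open>\<Delta>\<^sub>R(D) \<subseteq> H \<otimes> D\<close> at once. The axioms of \<open>R\<close>, together with their consequence
  \<open>(S \<otimes> S)R = R\<close>, yield a second formula \<open>\<Delta>\<^sub>R(h) = R\<^sup>2 \<cdot> h\<^sub>2 \<otimes> R\<^sup>1 h\<^sub>1\<close>
  (lemma \<open>transmuted_comult_flip_sum\<close>), from which \<open>\<Delta>\<^sub>R(D) \<subseteq> D \<otimes> H\<close>. Over a field
  \<open>(D \<otimes> H) \<inter> (H \<otimes> D) = D \<otimes> D\<close> (lemma \<open>in_tensor_Int\<close>), hence \<open>D\<close> is a subcoalgebra of \<open>H\<^sub>R\<close>.

  Conversely, the passage from \<open>\<Delta>\<close> to \<open>\<Delta>\<^sub>R\<close> is inverted by \<open>Q = R\<^sup>-\<^sup>1\<close>: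
  applying \<open>a \<otimes> b \<mapsto> a S(Q\<^sup>2) \<otimes> Q\<^sup>1 \<cdot> b\<close> to \<open>\<Delta>\<^sub>R(h)\<close> gives
  \<open>h\<^sub>1 S(Q\<^sup>2 R\<^sup>2) \<otimes> Q\<^sup>1 R\<^sup>1 \<cdot> h\<^sub>2 = \<Delta>(h)\<close>. This map preserves \<open>H \<otimes> E\<close> when \<open>E\<close> is stable, so a
  stable subcoalgebra \<open>E\<close> of \<open>H\<^sub>R\<close> satisfies \<open>\<Delta>(E) \<subseteq> H \<otimes> E\<close>.

  That \<open>H\<close> itself is a Yetter-Drinfeld module comes down to the antipode being anti-multiplicative
  and anti-comultiplicative (lemmas \<open>antipode_mult\<close> and \<open>comult_antipode_sum\<close>).

  Equalities of tensors are never handled through the defining congruence. Two lists of pairs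
  represent the same tensor iff every bilinear form has the same sum over both
  (lemmas \<open>tensor2_imp_sum_eq\<close> and \<open>tensor2I\<close>), and likewise vectors are compared through linear
  functionals. A Sweedler computation thereby becomes a chain of equations between iterated
  finite sums in the ground field, in which Sweedler components are bound variables and each
  axiom can be applied underneath the summation signs, given that the summand is linear in each
  component.
\<close>

section \<open>Tensors and bilinear forms\<close>

lemma sum_list_pair_cong:
  "(\<And>a b. (a, b) \<in> set xs \<Longrightarrow> F a b = G a b) \<Longrightarrow> (\<Sum>(a, b)\<leftarrow>xs. F a b) = (\<Sum>(a, b)\<leftarrow>xs. G a b)"
  by (induction xs) auto

lemma sum_list_pair_swap:
  fixes F :: "_ \<Rightarrow> _ \<Rightarrow> _ \<Rightarrow> _ \<Rightarrow> 'c::comm_monoid_add"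
  shows "(\<Sum>(a, b)\<leftarrow>xs. \<Sum>(c, d)\<leftarrow>ys. F a b c d) = (\<Sum>(c, d)\<leftarrow>ys. \<Sum>(a, b)\<leftarrow>xs. F a b c d)"
proof (induction xs)
  case Nil
  show ?case by (induction ys) auto
next
  case (Cons x xs)
  obtain a b where x: "x = (a, b)" by fastforce
  have "(\<Sum>(c, d)\<leftarrow>ys. F a b c d + (\<Sum>(a, b)\<leftarrow>xs. F a b c d))
      = (\<Sum>(c, d)\<leftarrow>ys. F a b c d) + (\<Sum>(c, d)\<leftarrow>ys. \<Sum>(a, b)\<leftarrow>xs. F a b c d)"
    by (induction ys) (auto simp: algebra_simps)
  with Cons show ?case by (simp add: x)
qed

lemma sum_list_pair_mult:
  fixes F :: "_ \<Rightarrow> _ \<Rightarrow> 'c::semiring_0"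
  shows "(\<Sum>(a, b)\<leftarrow>xs. r * F a b) = r * (\<Sum>(a, b)\<leftarrow>xs. F a b)"
  by (induction xs) (auto simp: algebra_simps)

lemma sum_list_pair_concat:
  "(\<Sum>(a, b)\<leftarrow>concat (map (\<lambda>(x, y). G x y) xs). F a b) = (\<Sum>(x, y)\<leftarrow>xs. \<Sum>(a, b)\<leftarrow>G x y. F a b)"
  by (induction xs) auto

lemma sum_list_pair_map:
  "(\<Sum>(a, b)\<leftarrow>map (\<lambda>(x, y). (g x y, h x y)) xs. F a b) = (\<Sum>(x, y)\<leftarrow>xs. F (g x y) (h x y))"
  by (induction xs) auto

lemma sum_list_triple_concat:
  "(\<Sum>(a, b, c)\<leftarrow>concat (map (\<lambda>(x, y). G x y) xs). F a b c)
     = (\<Sum>(x, y)\<leftarrow>xs. \<Sum>(a, b, c)\<leftarrow>G x y. F a b c)"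
  by (induction xs) auto

lemma sum_list_triple_map:
  "(\<Sum>(a, b, c)\<leftarrow>map (\<lambda>(x, y). (g x y, h x y, k x y)) xs. F a b c)
     = (\<Sum>(x, y)\<leftarrow>xs. F (g x y) (h x y) (k x y))"
  by (induction xs) auto

text \<open>
  Expands sums over the list comprehensions by which Sweedler expressions are represented.
\<close>

lemmas sum_list_comprehension =
  sum_list_pair_concat sum_list_pair_map sum_list_triple_concat sum_list_triple_map

lemma tensor2_refl: "tensor2 s t xs xs"
  and tensor2_sym: "tensor2 s t xs ys \<Longrightarrow> tensor2 s t ys xs"
  and tensor2_trans [trans]: "tensor2 s t xs ys \<Longrightarrow> tensor2 s t ys zs \<Longrightarrow> tensor2 s t xs zs"
  and tensor2_comm: "tensor2 s t (xs @ ys) (ys @ xs)"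
  and tensor2_append:
    "tensor2 s t xs ys \<Longrightarrow> tensor2 s t xs' ys' \<Longrightarrow> tensor2 s t (xs @ xs') (ys @ ys')"
  and tensor2_rel: "tensor2_rel s t xs ys \<Longrightarrow> tensor2 s t xs ys"
  unfolding tensor2_def by (blast intro: sum_cong.intros)+

lemma tensor2_Cons: "tensor2 s t xs ys \<Longrightarrow> tensor2 s t (x # xs) (x # ys)"
  using tensor2_append[OF tensor2_refl, of s t xs ys "[x]"] by simp

lemma tensor2_Cons_append: "tensor2 s t (x # us @ vs) (us @ x # vs)"
  using tensor2_append[OF tensor2_comm[of s t "[x]" us] tensor2_refl[of s t vs]] by simp

lemma tensor2_uminus_append: "tensor2 s t ([(- a, b). (a, b)\<leftarrow>xs] @ xs) []"
proof (induction xs)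
  case Nil
  show ?case by (simp add: tensor2_refl)
next
  case (Cons x xs)
  obtain a b where x: "x = (a, b)" by fastforce
  let ?n = "[(- a, b). (a, b)\<leftarrow>xs]"
  have "tensor2 s t ((- a, b) # ?n @ (a, b) # xs) ((- a, b) # (a, b) # ?n @ xs)"
    by (intro tensor2_Cons tensor2_sym[OF tensor2_Cons_append])
  also have "tensor2 s t \<dots> ([(- a, b), (a, b)] @ [])"
    using tensor2_append[OF tensor2_refl Cons, of "[(- a, b), (a, b)]"] by simp
  also have "tensor2 s t \<dots> [(- a + a, b)]"
    using tensor2_sym[OF tensor2_rel[OF tensor2_rel.intros(3)], of s t "- a" b a] by simp
  also have "tensor2 s t \<dots> []"
    using tensor2_rel[OF tensor2_rel.intros(1)] by simp
  finally show ?case by (simp add: x)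
qed

locale tensor_calculus = vector_space scale
  for scale :: "'k::field \<Rightarrow> 'v::ab_group_add \<Rightarrow> 'v"
begin

definition functional :: "('v \<Rightarrow> 'k) \<Rightarrow> bool" where
  "functional f \<longleftrightarrow> Vector_Spaces.linear scale (*) f"

definition endo :: "('v \<Rightarrow> 'v) \<Rightarrow> bool" where
  "endo g \<longleftrightarrow> Vector_Spaces.linear scale scale g"

definition bilinear_form :: "('v \<Rightarrow> 'v \<Rightarrow> 'k) \<Rightarrow> bool" where
  "bilinear_form F \<longleftrightarrow> (\<forall>y. functional (\<lambda>x. F x y)) \<and> (\<forall>x. functional (\<lambda>y. F x y))"

lemma field_vector_space: "vector_space ((*) :: 'k \<Rightarrow> 'k \<Rightarrow> 'k)"
  by unfold_locales (simp_all add: algebra_simps)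

lemma self_vector_space: "vector_space scale"
  by unfold_locales

lemma functional_iff:
  "functional f \<longleftrightarrow> (\<forall>x y. f (x + y) = f x + f y) \<and> (\<forall>r x. f (scale r x) = r * f x)"
  unfolding functional_def Vector_Spaces.linear_iff using field_vector_space self_vector_space by auto

lemma endo_iff:
  "endo g \<longleftrightarrow> (\<forall>x y. g (x + y) = g x + g y) \<and> (\<forall>r x. g (scale r x) = scale r (g x))"
  unfolding endo_def Vector_Spaces.linear_iff using self_vector_space by auto

lemma functional_add: "functional f \<Longrightarrow> f (x + y) = f x + f y"
  and functional_scale: "functional f \<Longrightarrow> f (scale r x) = r * f x"
  by (simp_all add: functional_iff)

lemma functional_zero: "functional f \<Longrightarrow> f 0 = 0"
  using functional_scale[of f 0 0] by simp

lemma functional_uminus: "functional f \<Longrightarrow> f (- x) = - f x"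
  using functional_add[of f x "- x"] functional_zero[of f] by (simp add: eq_neg_iff_add_eq_0 add.commute)

lemma functional_diff: "functional f \<Longrightarrow> f (x - y) = f x - f y"
  using functional_add[of f x "- y"] functional_uminus[of f y] by simp

lemma functional_sum_list:
  assumes "functional f"
  shows "f (\<Sum>(a, b)\<leftarrow>xs. F a b) = (\<Sum>(a, b)\<leftarrow>xs. f (F a b))"
  by (induction xs) (auto simp: functional_zero[OF assms] functional_add[OF assms])

text \<open>
  Syntax-directed rules by which a Sweedler expression is recognized as linear in one of its
  variables. The operations of a Hopf algebra contribute further rules below.
\<close>

named_theorems linear_rules

lemma endo_id [linear_rules]: "endo (\<lambda>x. x)"
  by (simp add: endo_iff)

lemma functional_mult [linear_rules]:
  "functional f \<Longrightarrow> functional (\<lambda>x. c * f x)"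
  "functional f \<Longrightarrow> functional (\<lambda>x. f x * c)"
  by (simp_all add: functional_iff algebra_simps)

lemma functional_pair_sum [linear_rules]:
  "(\<And>a b. functional (\<lambda>x. F a b x)) \<Longrightarrow> functional (\<lambda>x. \<Sum>(a, b)\<leftarrow>xs. F a b x)"
  unfolding functional_iff by (induction xs) (auto simp: algebra_simps)

lemma endo_pair_sum [linear_rules]:
  "(\<And>a b. endo (\<lambda>x. F a b x)) \<Longrightarrow> endo (\<lambda>x. \<Sum>(a, b)\<leftarrow>xs. F a b x)"
  unfolding endo_iff by (induction xs) (auto simp: algebra_simps)

lemma functional_comp: "functional f \<Longrightarrow> endo g \<Longrightarrow> functional (\<lambda>x. f (g x))"
  by (simp add: functional_iff endo_iff)

lemma bilinear_formI:
  "(\<And>y. functional (\<lambda>x. F x y)) \<Longrightarrow> (\<And>x. functional (\<lambda>y. F x y)) \<Longrightarrow> bilinear_form F"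
  by (simp add: bilinear_form_def)

lemma bilinear_left: "bilinear_form F \<Longrightarrow> endo g \<Longrightarrow> functional (\<lambda>x. F (g x) c)"
  and bilinear_right: "bilinear_form F \<Longrightarrow> endo g \<Longrightarrow> functional (\<lambda>x. F c (g x))"
  by (auto simp: bilinear_form_def intro: functional_comp)

lemma bilinear_form_mult:
  "functional f \<Longrightarrow> functional g \<Longrightarrow> bilinear_form (\<lambda>x y. f x * g y)"
  by (auto intro: bilinear_formI functional_mult)

lemma ex_functional_separating:
  assumes "subspace U" "x \<notin> U"
  shows "\<exists>f. functional f \<and> f x = 1 \<and> (\<forall>u\<in>U. f u = 0)"
proof -
  interpret pair: vector_space_pair scale "(*) :: 'k \<Rightarrow> 'k \<Rightarrow> 'k"
    by (intro vector_space_pair.intro field_vector_space self_vector_space)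
  obtain B where B: "B \<subseteq> U" "independent B" "U \<subseteq> span B"
    using maximal_independent_subset by blast
  have "span B = U" using B assms(1) by (simp add: span_minimal subset_antisym)
  then have "independent (insert x B)" "x \<notin> B"
    using B assms(2) independent_insertI[of x B] by auto
  then obtain f where f: "Vector_Spaces.linear scale (*) f"
      "\<forall>b\<in>insert x B. f b = (if b = x then 1 else 0)"
    using pair.linear_independent_extend[of "insert x B" "\<lambda>b. if b = x then 1 else 0"] by blast
  have "functional f" using f(1) by (simp add: functional_def)
  moreover have "f u = 0" if "u \<in> span B" for u
    using that
  proof (induction rule: span_induct_alt)
    case base
    show ?case by (rule functional_zero) fact
  next
    case (step c b u)
    then have "f b = 0" using f(2) \<open>x \<notin> B\<close> by auto
    with step show ?case
      using \<open>functional f\<close> by (simp add: functional_iff)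
  qed
  ultimately show ?thesis using f(2) \<open>span B = U\<close> by auto
qed

lemma functional_ext:
  assumes "\<And>f. functional f \<Longrightarrow> f x = f y"
  shows "x = y"
proof (rule ccontr)
  assume "x \<noteq> y"
  then obtain f where "functional f" "f (x - y) = 1"
    using ex_functional_separating[of "{0}" "x - y"] by (auto simp: subspace_0)
  with assms[of f] show False by (simp add: functional_diff)
qed

lemma ex_projection:
  assumes "subspace U"
  shows "\<exists>p. endo p \<and> range p \<subseteq> U \<and> (\<forall>u\<in>U. p u = u)"
proof -
  interpret pair: vector_space_pair scale scale
    by (intro vector_space_pair.intro self_vector_space)
  have "Vector_Spaces.linear scale scale (\<lambda>x. x)"
    using endo_id by (simp add: endo_def)
  from pair.linear_exists_left_inverse_on[OF this assms] show ?thesis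
    by (auto simp: endo_def)
qed

lemma tensor2_imp_sum_eq:
  assumes "tensor2 scale scale xs ys" "bilinear_form F"
  shows "(\<Sum>(x, y)\<leftarrow>xs. F x y) = (\<Sum>(x, y)\<leftarrow>ys. F x y)"
  using assms(1) unfolding tensor2_def
proof (induction rule: sum_cong.induct)
  case (gen xs ys)
  have l: "functional (\<lambda>x. F x y)" and r: "functional (\<lambda>y. F x y)" for x y
    using assms(2) by (auto simp: bilinear_form_def)
  from gen show ?case
    by (cases rule: tensor2_rel.cases)
      (simp_all add: functional_zero[OF l] functional_zero[OF r] functional_add[OF l]
        functional_add[OF r] functional_scale[OF l] functional_scale[OF r])
qed (simp_all add: add.commute)

lemma tensor3_imp_sum_eq:
  assumes "tensor3 scale scale scale xs ys"
    and 1: "\<And>b c. functional (\<lambda>a. F a b c)"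
    and 2: "\<And>a c. functional (\<lambda>b. F a b c)"
    and 3: "\<And>a b. functional (\<lambda>c. F a b c)"
  shows "(\<Sum>(a, b, c)\<leftarrow>xs. F a b c) = (\<Sum>(a, b, c)\<leftarrow>ys. F a b c)"
  using assms(1) unfolding tensor3_def
proof (induction rule: sum_cong.induct)
  case (gen xs ys)
  then show ?case
    by (cases rule: tensor3_rel.cases)
      (simp_all add: 1[THEN functional_zero] 2[THEN functional_zero] 3[THEN functional_zero]
        1[THEN functional_add] 2[THEN functional_add] 3[THEN functional_add]
        1[THEN functional_scale] 2[THEN functional_scale] 3[THEN functional_scale])
qed (simp_all add: add.commute)

text \<open>
  The first components of the left-hand list are kept, in order and with repetitions: the vector
  \<open>x\<close> is expanded in them and every resulting \<open>c b \<otimes> y = b \<otimes> c y\<close> is merged into an entry with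
  first component \<open>b\<close>. The list becomes shorter by one, which drives the induction below.
\<close>

lemma tensor2_absorb:
  assumes "x \<in> span (fst ` set xs)"
  shows "\<exists>ys. map fst ys = map fst xs \<and> tensor2 scale scale ((x, y) # xs) ys"
  using assms
proof (induction arbitrary: y rule: span_induct_alt)
  case base
  have "tensor2 scale scale ((0, y) # xs) xs"
    using tensor2_append[OF tensor2_rel[OF tensor2_rel.intros(1)] tensor2_refl] by fastforce
  then show ?case by blast
next
  case (step c b u)
  then obtain ys where ys: "map fst ys = map fst xs" "tensor2 scale scale ((u, y) # xs) ys"
    by blast
  from step(1) ys(1) have "b \<in> fst ` set ys" by (metis list.set_map)
  then obtain z where "(b, z) \<in> set ys" by auto
  then obtain us vs where ys_eq: "ys = us @ (b, z) # vs" by (auto dest: split_list)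
  have "tensor2 scale scale ((scale c b + u, y) # xs) ((scale c b, y) # (u, y) # xs)"
    using tensor2_append[OF tensor2_rel[OF tensor2_rel.intros(3)] tensor2_refl] by fastforce
  also have "tensor2 scale scale \<dots> ((scale c b, y) # ys)"
    by (intro tensor2_Cons ys)
  also have "tensor2 scale scale \<dots> ((b, scale c y) # ys)"
    using tensor2_append[OF tensor2_rel[OF tensor2_rel.intros(5)] tensor2_refl] by fastforce
  also have "tensor2 scale scale \<dots> (us @ (b, scale c y) # (b, z) # vs)"
    unfolding ys_eq by (rule tensor2_Cons_append)
  also have "tensor2 scale scale \<dots> (us @ (b, scale c y + z) # vs)"
  proof (intro tensor2_append tensor2_refl)
    show "tensor2 scale scale ((b, scale c y) # (b, z) # vs) ((b, scale c y + z) # vs)"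
      using tensor2_append[OF tensor2_sym[OF tensor2_rel[OF tensor2_rel.intros(4)]] tensor2_refl]
      by fastforce
  qed
  finally show ?case
    using ys(1) ys_eq by (intro exI[of _ "us @ (b, scale c y + z) # vs"]) simp
qed

text \<open>
  If the first component \<open>x\<close> of some entry lies in the span of the others, the entry can be absorbed.
  Otherwise a functional that is \<open>1\<close> at \<open>x\<close> and vanishes at the other first components shows that
  every functional kills the second component of the entry, which is therefore \<open>0\<close>.
\<close>

lemma tensor2_Nil_if_forms_vanish:
  assumes "\<And>f g. functional f \<Longrightarrow> functional g \<Longrightarrow> (\<Sum>(x, y)\<leftarrow>xs. f x * g y) = 0"
  shows "tensor2 scale scale xs []"
  using assms
proof (induction "length xs" arbitrary: xs)
  case 0
  then show ?case by (simp add: tensor2_refl)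
next
  case (Suc n)
  then obtain x y xs' where xs: "xs = (x, y) # xs'" by (cases xs) auto
  show ?case
  proof (cases "x \<in> span (fst ` set xs')")
    case True
    then obtain ys where ys: "map fst ys = map fst xs'" "tensor2 scale scale xs ys"
      using tensor2_absorb xs by blast
    from ys(1) have "length ys = length xs'" by (metis length_map)
    then have "n = length ys" using Suc(2) xs by simp
    moreover have "(\<Sum>(x, y)\<leftarrow>ys. f x * g y) = 0" if "functional f" "functional g" for f g
      using tensor2_imp_sum_eq[OF ys(2) bilinear_form_mult[OF that]] Suc(3)[OF that] by simp
    ultimately have "tensor2 scale scale ys []" by (intro Suc(1))
    with ys(2) show ?thesis by (rule tensor2_trans)
  next
    case False
    then obtain f where f: "functional f" "f x = 1" "\<And>u. u \<in> span (fst ` set xs') \<Longrightarrow> f u = 0"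
      using ex_functional_separating[OF subspace_span] by blast
    have "y = 0"
    proof (rule functional_ext)
      fix g assume g: "functional g"
      have "(\<Sum>(a, b)\<leftarrow>xs'. f a * g b) = (\<Sum>(a, b)\<leftarrow>xs'. 0)"
        using f(3) by (intro sum_list_pair_cong) (metis fst_conv image_eqI mult_zero_left span_base)
      also have "\<dots> = 0" by (induction xs') auto
      finally show "g y = g 0"
        using Suc(3)[OF f(1) g] xs f(2) functional_zero[OF g] by simp
    qed
    then have *: "tensor2 scale scale xs xs'"
      unfolding xs using tensor2_append[OF tensor2_rel[OF tensor2_rel.intros(2)] tensor2_refl]
      by fastforce
    have "n = length xs'" using Suc(2) xs by simp
    moreover have "(\<Sum>(x, y)\<leftarrow>xs'. f x * g y) = 0" if "functional f" "functional g" for f g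
      using tensor2_imp_sum_eq[OF * bilinear_form_mult[OF that]] Suc(3)[OF that] by simp
    ultimately have "tensor2 scale scale xs' []" by (intro Suc(1))
    with * show ?thesis by (rule tensor2_trans)
  qed
qed

text \<open>
  Bilinear forms separate tensors; with \<open>tensor2_imp_sum_eq\<close>, this turns equality in the tensor
  product into equality of sums in the field.
\<close>

lemma tensor2I:
  assumes "\<And>F. bilinear_form F \<Longrightarrow> (\<Sum>(x, y)\<leftarrow>xs. F x y) = (\<Sum>(x, y)\<leftarrow>ys. F x y)"
  shows "tensor2 scale scale xs ys"
proof -
  let ?n = "[(- a, b). (a, b)\<leftarrow>ys]"
  have "tensor2 scale scale (xs @ ?n) []"
  proof (rule tensor2_Nil_if_forms_vanish)
    fix f g assume fg: "functional f" "functional g"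
    have "(\<Sum>(a, b)\<leftarrow>?n. f a * g b) = - (\<Sum>(a, b)\<leftarrow>ys. f a * g b)"
      by (induction ys) (auto simp: functional_uminus[OF fg(1)])
    then show "(\<Sum>(a, b)\<leftarrow>xs @ ?n. f a * g b) = 0"
      using assms[OF bilinear_form_mult[OF fg]] by simp
  qed
  from tensor2_append[OF this tensor2_refl[of _ _ ys]]
  have "tensor2 scale scale (xs @ ?n @ ys) ys" by simp
  moreover have "tensor2 scale scale (xs @ ?n @ ys) xs"
    using tensor2_append[OF tensor2_refl[of _ _ xs] tensor2_uminus_append[of _ _ ys]] by simp
  ultimately show ?thesis by (blast intro: tensor2_sym tensor2_trans)
qed

text \<open>
  Linear projections \<open>p\<close> onto \<open>U\<close> and \<open>q\<close> onto \<open>W\<close> show this: \<open>p \<otimes> id\<close> fixes a tensor in \<open>U \<otimes> V\<close>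
  and \<open>id \<otimes> q\<close> fixes one in \<open>V \<otimes> W\<close>, so \<open>p \<otimes> q\<close> fixes a tensor that lies in both and moreover
  rewrites it with all components in \<open>U\<close> and \<open>W\<close>.
\<close>

lemma in_tensor_Int:
  assumes U: "subspace U" and W: "subspace W"
    and 1: "in_tensor scale scale U UNIV xs" and 2: "in_tensor scale scale UNIV W xs"
  shows "in_tensor scale scale U W xs"
proof -
  obtain ys where ys: "set ys \<subseteq> U \<times> UNIV" "tensor2 scale scale xs ys"
    using 1 by (auto simp: in_tensor_def)
  obtain zs where zs: "set zs \<subseteq> UNIV \<times> W" "tensor2 scale scale xs zs"
    using 2 by (auto simp: in_tensor_def)
  obtain p where p: "endo p" "range p \<subseteq> U" "\<And>u. u \<in> U \<Longrightarrow> p u = u"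
    using ex_projection[OF U] by blast
  obtain q where q: "endo q" "range q \<subseteq> W" "\<And>w. w \<in> W \<Longrightarrow> q w = w"
    using ex_projection[OF W] by blast
  have "tensor2 scale scale xs [(p x, q y). (x, y)\<leftarrow>xs]"
  proof (rule tensor2I)
    fix F assume F: "bilinear_form F"
    note rules = bilinear_formI bilinear_left[OF F] bilinear_right[OF F] p(1) q(1) endo_id
    have "(\<Sum>(x, y)\<leftarrow>xs. F x y) = (\<Sum>(x, y)\<leftarrow>ys. F x y)"
      by (rule tensor2_imp_sum_eq[OF ys(2) F])
    also have "\<dots> = (\<Sum>(x, y)\<leftarrow>ys. F (p x) y)"
      using ys(1) p(3) by (intro sum_list_pair_cong) fastforce
    also have "\<dots> = (\<Sum>(x, y)\<leftarrow>xs. F (p x) y)"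
      by (rule tensor2_imp_sum_eq[OF ys(2), symmetric]) (intro rules)
    also have "\<dots> = (\<Sum>(x, y)\<leftarrow>zs. F (p x) y)"
      by (rule tensor2_imp_sum_eq[OF zs(2)]) (intro rules)
    also have "\<dots> = (\<Sum>(x, y)\<leftarrow>zs. F (p x) (q y))"
      using zs(1) q(3) by (intro sum_list_pair_cong) fastforce
    also have "\<dots> = (\<Sum>(x, y)\<leftarrow>xs. F (p x) (q y))"
      by (rule tensor2_imp_sum_eq[OF zs(2), symmetric]) (intro rules)
    finally show "(\<Sum>(x, y)\<leftarrow>xs. F x y) = (\<Sum>(a, b)\<leftarrow>[(p x, q y). (x, y)\<leftarrow>xs]. F a b)"
      by (simp only: sum_list_comprehension)
  qed
  moreover have "set [(p x, q y). (x, y)\<leftarrow>xs] \<subseteq> U \<times> W"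
    using p(2) q(2) by auto
  ultimately show ?thesis unfolding in_tensor_def by blast
qed

end

section \<open>Sweedler calculus and the antipode\<close>

sublocale hopf_algebra \<subseteq> tensor_calculus s ..

context hopf_algebra
begin

lemma endo_mult [linear_rules]:
  "endo g \<Longrightarrow> endo (\<lambda>x. c * g x)"
  "endo g \<Longrightarrow> endo (\<lambda>x. g x * c)"
  by (simp_all add: endo_iff algebra_simps scale_mult_left scale_mult_right)

lemma endo_antipode [linear_rules]: "endo g \<Longrightarrow> endo (\<lambda>x. S (g x))"
  using antipode_linear by (auto simp: endo_iff Vector_Spaces.linear_iff)

lemma functional_counit [linear_rules]: "endo g \<Longrightarrow> functional (\<lambda>x. \<epsilon> (g x))"
  using counit_linear by (auto simp: endo_iff functional_iff Vector_Spaces.linear_iff)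

lemma functional_comult [linear_rules]:
  assumes 1: "\<And>b. functional (\<lambda>a. F a b)" and 2: "\<And>a. functional (\<lambda>b. F a b)" and g: "endo g"
  shows "functional (\<lambda>x. \<Sum>(a, b)\<leftarrow>\<Delta> (g x). F a b)"
proof -
  note F = bilinear_formI[of F, OF 1 2]
  have "(\<Sum>(a, b)\<leftarrow>\<Delta> (x + y). F a b) = (\<Sum>(a, b)\<leftarrow>\<Delta> x. F a b) + (\<Sum>(a, b)\<leftarrow>\<Delta> y. F a b)" for x y
    using tensor2_imp_sum_eq[OF comult_add F] by simp
  moreover have "(\<Sum>(a, b)\<leftarrow>\<Delta> (s r x). F a b) = r * (\<Sum>(a, b)\<leftarrow>\<Delta> x. F a b)" for r x
  proof -
    have "(\<Sum>(a, b)\<leftarrow>\<Delta> (s r x). F a b) = (\<Sum>(a, b)\<leftarrow>\<Delta> x. F (s r a) b)"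
      using tensor2_imp_sum_eq[OF comult_scale F] by (simp only: sum_list_comprehension)
    also have "\<dots> = (\<Sum>(a, b)\<leftarrow>\<Delta> x. r * F a b)"
      using functional_scale[OF 1] by simp
    also have "\<dots> = r * (\<Sum>(a, b)\<leftarrow>\<Delta> x. F a b)"
      by (rule sum_list_pair_mult)
    finally show ?thesis .
  qed
  ultimately show ?thesis
    using g by (simp add: functional_iff endo_iff)
qed

lemma coassoc_sum:
  assumes "\<And>b c. functional (\<lambda>a. F a b c)" "\<And>a c. functional (\<lambda>b. F a b c)"
    "\<And>a b. functional (\<lambda>c. F a b c)"
  shows "(\<Sum>(x, y)\<leftarrow>\<Delta> a. \<Sum>(p, q)\<leftarrow>\<Delta> x. F p q y) = (\<Sum>(x, y)\<leftarrow>\<Delta> a. \<Sum>(p, q)\<leftarrow>\<Delta> y. F x p q)"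
  using tensor3_imp_sum_eq[OF coassoc assms, of a] by (simp only: sum_list_comprehension prod.case)

lemma counit_left_sum: "functional f \<Longrightarrow> (\<Sum>(x, y)\<leftarrow>\<Delta> a. \<epsilon> x * f y) = f a"
  using functional_sum_list[of f "\<lambda>x y. s (\<epsilon> x) y" "\<Delta> a"]
  by (simp add: functional_scale counit_left)

lemma counit_right_sum: "functional f \<Longrightarrow> (\<Sum>(x, y)\<leftarrow>\<Delta> a. \<epsilon> y * f x) = f a"
  using functional_sum_list[of f "\<lambda>x y. s (\<epsilon> y) x" "\<Delta> a"]
  by (simp add: functional_scale counit_right)

lemma comult_mult_sum:
  "bilinear_form F \<Longrightarrow>
    (\<Sum>(x, y)\<leftarrow>\<Delta> (a * b). F x y) = (\<Sum>(x, y)\<leftarrow>\<Delta> a. \<Sum>(x', y')\<leftarrow>\<Delta> b. F (x * x') (y * y'))"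
  using tensor2_imp_sum_eq[OF comult_mult] by (simp only: sum_list_comprehension)

lemma comult_one_sum: "bilinear_form F \<Longrightarrow> (\<Sum>(x, y)\<leftarrow>\<Delta> 1. F x y) = F 1 1"
  using tensor2_imp_sum_eq[OF comult_one] by simp

lemma antipode_left_sum: "functional f \<Longrightarrow> (\<Sum>(x, y)\<leftarrow>\<Delta> a. f (S x * y)) = \<epsilon> a * f 1"
  using functional_sum_list[of f "\<lambda>x y. S x * y" "\<Delta> a"] by (simp add: functional_scale antipode_left)

lemma antipode_right_sum: "functional f \<Longrightarrow> (\<Sum>(x, y)\<leftarrow>\<Delta> a. f (x * S y)) = \<epsilon> a * f 1"
  using functional_sum_list[of f "\<lambda>x y. x * S y" "\<Delta> a"] by (simp add: functional_scale antipode_right)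

lemma antipode_one: "S 1 = 1"
proof (rule functional_ext)
  fix f assume f: "functional f"
  have "bilinear_form (\<lambda>x y. f (S x * y))"
    by (intro bilinear_formI functional_comp[OF f] linear_rules)
  from comult_one_sum[OF this] show "f (S 1) = f 1"
    using antipode_left_sum[OF f, of 1] by (simp add: counit_one)
qed

text \<open>
  Both sides are convolution inverses of the multiplication \<open>H \<otimes> H \<rightarrow> H\<close>. Spelled out, the expression
  \<open>S(a\<^sub>1 b\<^sub>1) a\<^sub>2 b\<^sub>2 S(b\<^sub>3) S(a\<^sub>3)\<close> is evaluated twice, by contracting \<open>b\<^sub>2 S(b\<^sub>3)\<close> and then
  \<open>a\<^sub>2 S(a\<^sub>3)\<close>, or by contracting \<open>S(a\<^sub>1 b\<^sub>1) (a\<^sub>2 b\<^sub>2)\<close>.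
\<close>

lemma antipode_mult: "S (a * b) = S b * S a"
proof (rule functional_ext)
  fix f assume f: "functional f"
  note linear = bilinear_formI functional_comp[OF f] linear_rules
  let ?F = "\<lambda>a1 a2 a3 b1 b2 b3. f (S (a1 * b1) * ((a2 * b2) * (S b3 * S a3)))"
  have b: "(\<Sum>(b1, b')\<leftarrow>\<Delta> b. \<Sum>(b2, b3)\<leftarrow>\<Delta> b'. ?F a1 a2 a3 b1 b2 b3)
      = f (S (a1 * b) * (a2 * S a3))" for a1 a2 a3
  proof -
    have "(\<Sum>(b2, b3)\<leftarrow>\<Delta> b'. ?F a1 a2 a3 b1 b2 b3) = \<epsilon> b' * f (S (a1 * b1) * (a2 * S a3))" for b1 b'
      using antipode_right_sum[of "\<lambda>z. f (S (a1 * b1) * (a2 * (z * S a3)))" b']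
      by (simp add: mult.assoc linear)
    then have "(\<Sum>(b1, b')\<leftarrow>\<Delta> b. \<Sum>(b2, b3)\<leftarrow>\<Delta> b'. ?F a1 a2 a3 b1 b2 b3)
        = (\<Sum>(b1, b')\<leftarrow>\<Delta> b. \<epsilon> b' * f (S (a1 * b1) * (a2 * S a3)))"
      by simp
    also have "\<dots> = f (S (a1 * b) * (a2 * S a3))"
      by (intro counit_right_sum linear)
    finally show ?thesis .
  qed
  have "f (S (a * b)) = (\<Sum>(a1, a')\<leftarrow>\<Delta> a. \<epsilon> a' * f (S (a1 * b)))"
    by (intro counit_right_sum[symmetric] linear)
  also have "\<dots> = (\<Sum>(a1, a')\<leftarrow>\<Delta> a. \<Sum>(a2, a3)\<leftarrow>\<Delta> a'. f (S (a1 * b) * (a2 * S a3)))"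
  proof (intro sum_list_pair_cong)
    fix a1 a'
    show "\<epsilon> a' * f (S (a1 * b)) = (\<Sum>(a2, a3)\<leftarrow>\<Delta> a'. f (S (a1 * b) * (a2 * S a3)))"
      using antipode_right_sum[of "\<lambda>z. f (S (a1 * b) * z)" a'] by (simp add: linear)
  qed
  also have "\<dots> = (\<Sum>(a1, a')\<leftarrow>\<Delta> a. \<Sum>(a2, a3)\<leftarrow>\<Delta> a'.
      \<Sum>(b1, b')\<leftarrow>\<Delta> b. \<Sum>(b2, b3)\<leftarrow>\<Delta> b'. ?F a1 a2 a3 b1 b2 b3)"
    by (simp only: b)
  also have "\<dots> = (\<Sum>(a1, a')\<leftarrow>\<Delta> a. \<Sum>(a2, a3)\<leftarrow>\<Delta> a'.
      \<Sum>(b', b3)\<leftarrow>\<Delta> b. \<Sum>(b1, b2)\<leftarrow>\<Delta> b'. ?F a1 a2 a3 b1 b2 b3)"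
    by (intro sum_list_pair_cong coassoc_sum[symmetric] linear)
  also have "\<dots> = (\<Sum>(a', a3)\<leftarrow>\<Delta> a. \<Sum>(a1, a2)\<leftarrow>\<Delta> a'.
      \<Sum>(b', b3)\<leftarrow>\<Delta> b. \<Sum>(b1, b2)\<leftarrow>\<Delta> b'. ?F a1 a2 a3 b1 b2 b3)"
    by (intro coassoc_sum[symmetric] linear)
  also have "\<dots> = (\<Sum>(a', a3)\<leftarrow>\<Delta> a. \<Sum>(b', b3)\<leftarrow>\<Delta> b.
      \<Sum>(a1, a2)\<leftarrow>\<Delta> a'. \<Sum>(b1, b2)\<leftarrow>\<Delta> b'. ?F a1 a2 a3 b1 b2 b3)"
    by (intro sum_list_pair_cong sum_list_pair_swap)
  also have "\<dots> = (\<Sum>(a', a3)\<leftarrow>\<Delta> a. \<Sum>(b', b3)\<leftarrow>\<Delta> b. \<epsilon> a' * (\<epsilon> b' * f (S b3 * S a3)))"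
  proof (intro sum_list_pair_cong)
    fix a' a3 b' b3
    have "(\<Sum>(a1, a2)\<leftarrow>\<Delta> a'. \<Sum>(b1, b2)\<leftarrow>\<Delta> b'. ?F a1 a2 a3 b1 b2 b3)
        = (\<Sum>(x, y)\<leftarrow>\<Delta> (a' * b'). f (S x * (y * (S b3 * S a3))))"
      by (intro comult_mult_sum[symmetric] linear)
    also have "\<dots> = \<epsilon> (a' * b') * f (S b3 * S a3)"
      using antipode_left_sum[of "\<lambda>z. f (z * (S b3 * S a3))" "a' * b'"]
      by (simp add: mult.assoc linear)
    finally show "(\<Sum>(a1, a2)\<leftarrow>\<Delta> a'. \<Sum>(b1, b2)\<leftarrow>\<Delta> b'. ?F a1 a2 a3 b1 b2 b3)
        = \<epsilon> a' * (\<epsilon> b' * f (S b3 * S a3))"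
      by (simp add: counit_mult mult.assoc)
  qed
  also have "\<dots> = (\<Sum>(a', a3)\<leftarrow>\<Delta> a. \<epsilon> a' * f (S b * S a3))"
  proof (intro sum_list_pair_cong)
    fix a' a3
    show "(\<Sum>(b', b3)\<leftarrow>\<Delta> b. \<epsilon> a' * (\<epsilon> b' * f (S b3 * S a3))) = \<epsilon> a' * f (S b * S a3)"
      using counit_left_sum[of "\<lambda>z. \<epsilon> a' * f (S z * S a3)" b]
      by (simp add: linear mult.left_commute)
  qed
  also have "\<dots> = f (S b * S a)"
    by (intro counit_left_sum linear)
  finally show "f (S (a * b)) = f (S b * S a)" .
qed

text \<open>
  Dual to \<open>antipode_mult\<close>: both \<open>\<Delta> \<circ> S\<close> and \<open>a \<mapsto> S(a\<^sub>2) \<otimes> S(a\<^sub>1)\<close> are convolution inverses of \<open>\<Delta>\<close>. The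
  expression evaluated twice is \<open>\<Delta>(S(a\<^sub>1)) (a\<^sub>2 \<otimes> a\<^sub>3) (S(a\<^sub>5) \<otimes> S(a\<^sub>4))\<close>: the last two factors contract
  from the inside, first \<open>a\<^sub>3 S(a\<^sub>4)\<close> and then \<open>a\<^sub>2 S(a\<^sub>5)\<close>, while the first two are
  \<open>\<Delta>(S(a\<^sub>1) a\<^sub>2)\<close> and contract to \<open>1 \<otimes> 1\<close>.
\<close>

lemma comult_antipode_sum:
  assumes F: "bilinear_form F"
  shows "(\<Sum>(x, y)\<leftarrow>\<Delta> (S a). F x y) = (\<Sum>(x, y)\<leftarrow>\<Delta> a. F (S y) (S x))"
proof -
  note linear = bilinear_formI bilinear_left[OF F] bilinear_right[OF F] linear_rules
  let ?F = "\<lambda>p q a2 a3 a4 a5. F (p * (a2 * S a5)) (q * (a3 * S a4))"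
  let ?G = "\<lambda>a1 a2 a3 c. \<Sum>(a4, a5)\<leftarrow>\<Delta> c. \<Sum>(p, q)\<leftarrow>\<Delta> (S a1). ?F p q a2 a3 a4 a5"
  \<comment> \<open>First evaluation: only the factor \<open>\<Delta>(S(a\<^sub>1))\<close> survives.\<close>
  have inner: "(\<Sum>(a2, b)\<leftarrow>\<Delta> a'. \<Sum>(a3, c)\<leftarrow>\<Delta> b. ?G a1 a2 a3 c)
      = \<epsilon> a' * (\<Sum>(p, q)\<leftarrow>\<Delta> (S a1). F p q)" for a1 a'
  proof -
    have 1: "(\<Sum>(a3, c)\<leftarrow>\<Delta> b. \<Sum>(a4, a5)\<leftarrow>\<Delta> c. ?F p q a2 a3 a4 a5) = F (p * (a2 * S b)) q"
      for a2 b p q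
    proof -
      have "(\<Sum>(a3, c)\<leftarrow>\<Delta> b. \<Sum>(a4, a5)\<leftarrow>\<Delta> c. ?F p q a2 a3 a4 a5)
          = (\<Sum>(d, a5)\<leftarrow>\<Delta> b. \<Sum>(a3, a4)\<leftarrow>\<Delta> d. ?F p q a2 a3 a4 a5)"
        by (intro coassoc_sum[symmetric] linear)
      also have "\<dots> = (\<Sum>(d, a5)\<leftarrow>\<Delta> b. \<epsilon> d * F (p * (a2 * S a5)) q)"
      proof (intro sum_list_pair_cong)
        fix d a5
        show "(\<Sum>(a3, a4)\<leftarrow>\<Delta> d. ?F p q a2 a3 a4 a5) = \<epsilon> d * F (p * (a2 * S a5)) q"
          using antipode_right_sum[of "\<lambda>z. F (p * (a2 * S a5)) (q * z)" d] by (simp add: linear)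
      qed
      also have "\<dots> = F (p * (a2 * S b)) q"
        by (intro counit_left_sum linear)
      finally show ?thesis .
    qed
    have 2: "(\<Sum>(a3, c)\<leftarrow>\<Delta> b. ?G a1 a2 a3 c) = (\<Sum>(p, q)\<leftarrow>\<Delta> (S a1). F (p * (a2 * S b)) q)" for a2 b
    proof -
      have "(\<Sum>(a3, c)\<leftarrow>\<Delta> b. ?G a1 a2 a3 c)
          = (\<Sum>(a3, c)\<leftarrow>\<Delta> b. \<Sum>(p, q)\<leftarrow>\<Delta> (S a1). \<Sum>(a4, a5)\<leftarrow>\<Delta> c. ?F p q a2 a3 a4 a5)"
        by (intro sum_list_pair_cong sum_list_pair_swap)
      also have "\<dots> = (\<Sum>(p, q)\<leftarrow>\<Delta> (S a1). \<Sum>(a3, c)\<leftarrow>\<Delta> b. \<Sum>(a4, a5)\<leftarrow>\<Delta> c. ?F p q a2 a3 a4 a5)"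
        by (rule sum_list_pair_swap)
      finally show ?thesis by (simp only: 1)
    qed
    have "(\<Sum>(a2, b)\<leftarrow>\<Delta> a'. \<Sum>(a3, c)\<leftarrow>\<Delta> b. ?G a1 a2 a3 c)
        = (\<Sum>(p, q)\<leftarrow>\<Delta> (S a1). \<Sum>(a2, b)\<leftarrow>\<Delta> a'. F (p * (a2 * S b)) q)"
      unfolding 2 by (rule sum_list_pair_swap)
    also have "\<dots> = (\<Sum>(p, q)\<leftarrow>\<Delta> (S a1). \<epsilon> a' * F p q)"
    proof (intro sum_list_pair_cong)
      fix p q
      show "(\<Sum>(a2, b)\<leftarrow>\<Delta> a'. F (p * (a2 * S b)) q) = \<epsilon> a' * F p q"
        using antipode_right_sum[of "\<lambda>z. F (p * z) q" a'] by (simp add: linear)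
    qed
    also have "\<dots> = \<epsilon> a' * (\<Sum>(p, q)\<leftarrow>\<Delta> (S a1). F p q)"
      by (rule sum_list_pair_mult)
    finally show ?thesis .
  qed
  have "(\<Sum>(x, y)\<leftarrow>\<Delta> (S a). F x y) = (\<Sum>(a1, a')\<leftarrow>\<Delta> a. \<epsilon> a' * (\<Sum>(p, q)\<leftarrow>\<Delta> (S a1). F p q))"
    by (intro counit_right_sum[symmetric] linear)
  also have "\<dots> = (\<Sum>(a1, a')\<leftarrow>\<Delta> a. \<Sum>(a2, b)\<leftarrow>\<Delta> a'. \<Sum>(a3, c)\<leftarrow>\<Delta> b. ?G a1 a2 a3 c)"
    by (simp only: inner)
  also have "\<dots> = (\<Sum>(a1, a')\<leftarrow>\<Delta> a. \<Sum>(e, c)\<leftarrow>\<Delta> a'. \<Sum>(a2, a3)\<leftarrow>\<Delta> e. ?G a1 a2 a3 c)"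
    by (intro sum_list_pair_cong coassoc_sum[symmetric] linear)
  also have "\<dots> = (\<Sum>(x, c)\<leftarrow>\<Delta> a. \<Sum>(a1, e)\<leftarrow>\<Delta> x. \<Sum>(a2, a3)\<leftarrow>\<Delta> e. ?G a1 a2 a3 c)"
    by (intro coassoc_sum[symmetric] linear)
  also have "\<dots> = (\<Sum>(x, c)\<leftarrow>\<Delta> a. \<epsilon> x * (\<Sum>(a4, a5)\<leftarrow>\<Delta> c. F (S a5) (S a4)))"
  proof (intro sum_list_pair_cong)
    fix x c
    \<comment> \<open>Second evaluation: only the factor \<open>S(a\<^sub>5) \<otimes> S(a\<^sub>4)\<close> survives.\<close>
    have 3: "(\<Sum>(a1, e)\<leftarrow>\<Delta> x. \<Sum>(a2, a3)\<leftarrow>\<Delta> e. \<Sum>(p, q)\<leftarrow>\<Delta> (S a1). ?F p q a2 a3 a4 a5)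
        = \<epsilon> x * F (S a5) (S a4)" for a4 a5
    proof -
      let ?F' = "\<lambda>u v. F (u * S a5) (v * S a4)"
      have F': "bilinear_form ?F'" by (intro linear)
      have "(\<Sum>(a1, e)\<leftarrow>\<Delta> x. \<Sum>(a2, a3)\<leftarrow>\<Delta> e. \<Sum>(p, q)\<leftarrow>\<Delta> (S a1). ?F p q a2 a3 a4 a5)
          = (\<Sum>(a1, e)\<leftarrow>\<Delta> x. \<Sum>(p, q)\<leftarrow>\<Delta> (S a1). \<Sum>(a2, a3)\<leftarrow>\<Delta> e. ?F p q a2 a3 a4 a5)"
        by (intro sum_list_pair_cong sum_list_pair_swap)
      also have "\<dots> = (\<Sum>(a1, e)\<leftarrow>\<Delta> x. \<Sum>(u, v)\<leftarrow>\<Delta> (S a1 * e). ?F' u v)"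
        using comult_mult_sum[OF F'] by (simp add: mult.assoc)
      also have "\<dots> = \<epsilon> x * (\<Sum>(u, v)\<leftarrow>\<Delta> 1. ?F' u v)"
        by (rule antipode_left_sum) (intro linear)
      also have "\<dots> = \<epsilon> x * F (S a5) (S a4)"
        using comult_one_sum[OF F'] by simp
      finally show ?thesis .
    qed
    have "(\<Sum>(a1, e)\<leftarrow>\<Delta> x. \<Sum>(a2, a3)\<leftarrow>\<Delta> e. ?G a1 a2 a3 c)
        = (\<Sum>(a1, e)\<leftarrow>\<Delta> x. \<Sum>(a4, a5)\<leftarrow>\<Delta> c. \<Sum>(a2, a3)\<leftarrow>\<Delta> e. \<Sum>(p, q)\<leftarrow>\<Delta> (S a1). ?F p q a2 a3 a4 a5)"
      by (intro sum_list_pair_cong sum_list_pair_swap)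
    also have "\<dots> = (\<Sum>(a4, a5)\<leftarrow>\<Delta> c.
        \<Sum>(a1, e)\<leftarrow>\<Delta> x. \<Sum>(a2, a3)\<leftarrow>\<Delta> e. \<Sum>(p, q)\<leftarrow>\<Delta> (S a1). ?F p q a2 a3 a4 a5)"
      by (rule sum_list_pair_swap)
    also have "\<dots> = \<epsilon> x * (\<Sum>(a4, a5)\<leftarrow>\<Delta> c. F (S a5) (S a4))"
      unfolding 3 by (rule sum_list_pair_mult)
    finally show "(\<Sum>(a1, e)\<leftarrow>\<Delta> x. \<Sum>(a2, a3)\<leftarrow>\<Delta> e. ?G a1 a2 a3 c) = \<dots>" .
  qed
  also have "\<dots> = (\<Sum>(x, y)\<leftarrow>\<Delta> a. F (S y) (S x))"
    by (intro counit_left_sum linear)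
  finally show ?thesis .
qed

section \<open>The adjoint Yetter-Drinfeld module\<close>

lemma functional_adjoint:
  "functional f \<Longrightarrow> f (adjoint \<Delta> S h a) = (\<Sum>(h1, h2)\<leftarrow>\<Delta> h. f (h1 * a * S h2))"
  unfolding adjoint_def by (rule functional_sum_list)

lemma endo_adjoint_right [linear_rules]:
  assumes "endo g"
  shows "endo (\<lambda>a. adjoint \<Delta> S h (g a))"
  unfolding adjoint_def by (intro linear_rules assms)

lemma endo_adjoint_left [linear_rules]:
  assumes "endo g"
  shows "endo (\<lambda>h. adjoint \<Delta> S (g h) a)"
proof -
  have "functional (\<lambda>h. f (adjoint \<Delta> S (g h) a))" if f: "functional f" for f
    unfolding functional_adjoint[OF f] by (intro functional_comp[OF f] linear_rules assms)
  then show ?thesis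
    unfolding endo_iff functional_iff[of "\<lambda>h. _ (adjoint \<Delta> S (g h) a)"]
    by (auto intro!: functional_ext simp: functional_add functional_scale)
qed

lemma adjoint_mult: "adjoint \<Delta> S (g * h) a = adjoint \<Delta> S g (adjoint \<Delta> S h a)"
proof (rule functional_ext)
  fix f assume f: "functional f"
  note linear = bilinear_formI functional_comp[OF f] linear_rules
  have "f (adjoint \<Delta> S (g * h) a)
      = (\<Sum>(g1, g2)\<leftarrow>\<Delta> g. \<Sum>(h1, h2)\<leftarrow>\<Delta> h. f ((g1 * h1) * a * S (g2 * h2)))"
    unfolding functional_adjoint[OF f] by (intro comult_mult_sum linear)
  also have "\<dots> = (\<Sum>(g1, g2)\<leftarrow>\<Delta> g. f (g1 * adjoint \<Delta> S h a * S g2))"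
  proof (intro sum_list_pair_cong)
    fix g1 g2
    have "functional (\<lambda>z. f (g1 * z * S g2))" by (intro linear)
    from functional_adjoint[OF this, of h a]
    show "(\<Sum>(h1, h2)\<leftarrow>\<Delta> h. f ((g1 * h1) * a * S (g2 * h2))) = f (g1 * adjoint \<Delta> S h a * S g2)"
      by (simp add: antipode_mult mult.assoc)
  qed
  finally show "f (adjoint \<Delta> S (g * h) a) = f (adjoint \<Delta> S g (adjoint \<Delta> S h a))"
    by (simp add: functional_adjoint[OF f])
qed

lemma adjoint_one: "adjoint \<Delta> S 1 a = a"
proof (rule functional_ext)
  fix f assume f: "functional f"
  have "bilinear_form (\<lambda>x y. f (x * a * S y))"
    by (intro bilinear_formI functional_comp[OF f] linear_rules)
  from comult_one_sum[OF this] show "f (adjoint \<Delta> S 1 a) = f a"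
    by (simp add: functional_adjoint[OF f] antipode_one)
qed

text \<open>
  The compatibility condition of the adjoint Yetter-Drinfeld module. Multiplicativity of \<open>\<Delta>\<close> and
  \<open>comult_antipode_sum\<close> give \<open>\<Delta>(h\<^sub>1 a S(h\<^sub>2)) = h\<^sub>1 a\<^sub>1 S(h\<^sub>4) \<otimes> h\<^sub>2 a\<^sub>2 S(h\<^sub>3)\<close>, in which \<open>h\<^sub>2\<close> and
  \<open>h\<^sub>3\<close> are collected into an adjoint action; what remains is to rebracket the fourfold coproduct
  from \<open>(12)(34)\<close> to \<open>(1(23))4\<close>.
\<close>

lemma comult_adjoint_sum:
  assumes F: "bilinear_form F"
  shows "(\<Sum>(x, y)\<leftarrow>\<Delta> (adjoint \<Delta> S h a). F x y)
    = (\<Sum>(h12, h3)\<leftarrow>\<Delta> h. \<Sum>(h1, h2)\<leftarrow>\<Delta> h12. \<Sum>(x, w)\<leftarrow>\<Delta> a. F (h1 * x * S h3) (adjoint \<Delta> S h2 w))"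
proof -
  note linear = bilinear_formI bilinear_left[OF F] bilinear_right[OF F] linear_rules
  let ?G = "\<lambda>h1 h2 h3 h4. \<Sum>(x, w)\<leftarrow>\<Delta> a. F (h1 * x * S h4) (h2 * w * S h3)"
  have "functional (\<lambda>z. \<Sum>(x, y)\<leftarrow>\<Delta> z. F x y)"
    by (intro linear)
  then have "(\<Sum>(x, y)\<leftarrow>\<Delta> (adjoint \<Delta> S h a). F x y)
      = (\<Sum>(k, l)\<leftarrow>\<Delta> h. \<Sum>(x, y)\<leftarrow>\<Delta> (k * a * S l). F x y)"
    by (rule functional_adjoint)
  also have "\<dots> = (\<Sum>(k, l)\<leftarrow>\<Delta> h. \<Sum>(h1, h2)\<leftarrow>\<Delta> k. \<Sum>(h3, h4)\<leftarrow>\<Delta> l. ?G h1 h2 h3 h4)"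
  proof (intro sum_list_pair_cong)
    fix k l
    have "(\<Sum>(x, y)\<leftarrow>\<Delta> (k * a * S l). F x y)
        = (\<Sum>(u, v)\<leftarrow>\<Delta> (k * a). \<Sum>(h4, h3)\<leftarrow>\<Delta> (S l). F (u * h4) (v * h3))"
      by (rule comult_mult_sum[OF F])
    also have "\<dots> = (\<Sum>(u, v)\<leftarrow>\<Delta> (k * a). \<Sum>(h3, h4)\<leftarrow>\<Delta> l. F (u * S h4) (v * S h3))"
      by (intro sum_list_pair_cong comult_antipode_sum linear)
    also have "\<dots> = (\<Sum>(h1, h2)\<leftarrow>\<Delta> k. \<Sum>(x, w)\<leftarrow>\<Delta> a. \<Sum>(h3, h4)\<leftarrow>\<Delta> l. F (h1 * x * S h4) (h2 * w * S h3))"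
      by (intro comult_mult_sum linear)
    also have "\<dots> = (\<Sum>(h1, h2)\<leftarrow>\<Delta> k. \<Sum>(h3, h4)\<leftarrow>\<Delta> l. ?G h1 h2 h3 h4)"
      by (intro sum_list_pair_cong sum_list_pair_swap)
    finally show "(\<Sum>(x, y)\<leftarrow>\<Delta> (k * a * S l). F x y) = \<dots>" .
  qed
  also have "\<dots> = (\<Sum>(k, l)\<leftarrow>\<Delta> h. \<Sum>(h3, h4)\<leftarrow>\<Delta> l. \<Sum>(h1, h2)\<leftarrow>\<Delta> k. ?G h1 h2 h3 h4)"
    by (intro sum_list_pair_cong sum_list_pair_swap)
  also have "\<dots> = (\<Sum>(k, h4)\<leftarrow>\<Delta> h. \<Sum>(k', h3)\<leftarrow>\<Delta> k. \<Sum>(h1, h2)\<leftarrow>\<Delta> k'. ?G h1 h2 h3 h4)"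
    by (intro coassoc_sum[symmetric] linear)
  also have "\<dots> = (\<Sum>(k, h4)\<leftarrow>\<Delta> h. \<Sum>(h1, l)\<leftarrow>\<Delta> k. \<Sum>(h2, h3)\<leftarrow>\<Delta> l. ?G h1 h2 h3 h4)"
    by (intro sum_list_pair_cong coassoc_sum linear)
  also have "\<dots> = (\<Sum>(k, h4)\<leftarrow>\<Delta> h. \<Sum>(h1, l)\<leftarrow>\<Delta> k. \<Sum>(x, w)\<leftarrow>\<Delta> a. F (h1 * x * S h4) (adjoint \<Delta> S l w))"
  proof (intro sum_list_pair_cong)
    fix k h4 h1 l
    have "(\<Sum>(h2, h3)\<leftarrow>\<Delta> l. ?G h1 h2 h3 h4)
        = (\<Sum>(x, w)\<leftarrow>\<Delta> a. \<Sum>(h2, h3)\<leftarrow>\<Delta> l. F (h1 * x * S h4) (h2 * w * S h3))"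
      by (rule sum_list_pair_swap)
    also have "\<dots> = (\<Sum>(x, w)\<leftarrow>\<Delta> a. F (h1 * x * S h4) (adjoint \<Delta> S l w))"
      by (intro sum_list_pair_cong functional_adjoint[symmetric] linear)
    finally show "(\<Sum>(h2, h3)\<leftarrow>\<Delta> l. ?G h1 h2 h3 h4) = \<dots>" .
  qed
  finally show ?thesis .
qed

lemma adjoint_yetter_drinfeld_module: "yetter_drinfeld_module s \<Delta> \<epsilon> S s (adjoint \<Delta> S) \<Delta>"
proof
  fix g h v w :: 'h and r :: 'k
  show "adjoint \<Delta> S (g + h) v = adjoint \<Delta> S g v + adjoint \<Delta> S h v"
    and "adjoint \<Delta> S (s r h) v = s r (adjoint \<Delta> S h v)"
    using endo_adjoint_left[OF endo_id] by (auto simp: endo_iff)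
  show "adjoint \<Delta> S h (v + w) = adjoint \<Delta> S h v + adjoint \<Delta> S h w"
    and "adjoint \<Delta> S h (s r v) = s r (adjoint \<Delta> S h v)"
    using endo_adjoint_right[OF endo_id] by (auto simp: endo_iff)
  show "tensor2 s s (\<Delta> (adjoint \<Delta> S h v))
      [(h1 * x * S h3, adjoint \<Delta> S h2 w). (h12, h3)\<leftarrow>\<Delta> h, (h1, h2)\<leftarrow>\<Delta> h12, (x, w)\<leftarrow>\<Delta> v]"
    by (rule tensor2I) (simp only: sum_list_comprehension comult_adjoint_sum)
qed (rule adjoint_mult adjoint_one comult_add comult_scale coassoc counit_left)+

end

section \<open>The universal R-matrix\<close>

context quasitriangular_hopf_algebra
begin

lemma R_comult_sum:
  "bilinear_form F \<Longrightarrow>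
    (\<Sum>(r1, r2)\<leftarrow>R. \<Sum>(h1, h2)\<leftarrow>\<Delta> h. F (r1 * h1) (r2 * h2))
      = (\<Sum>(r1, r2)\<leftarrow>R. \<Sum>(h1, h2)\<leftarrow>\<Delta> h. F (h2 * r1) (h1 * r2))"
  using tensor2_imp_sum_eq[OF R_comult] by (simp only: sum_list_comprehension)

lemma comult_id_R_sum:
  assumes "\<And>b c. functional (\<lambda>a. F a b c)" "\<And>a c. functional (\<lambda>b. F a b c)"
    "\<And>a b. functional (\<lambda>c. F a b c)"
  shows "(\<Sum>(r1, r2)\<leftarrow>R. \<Sum>(x, y)\<leftarrow>\<Delta> r1. F x y r2)
    = (\<Sum>(r1, r2)\<leftarrow>R. \<Sum>(r1', r2')\<leftarrow>R. F r1 r1' (r2 * r2'))"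
  using tensor3_imp_sum_eq[OF comult_id_R assms] by (simp only: sum_list_comprehension prod.case)

lemma id_comult_R_sum:
  assumes "\<And>b c. functional (\<lambda>a. F a b c)" "\<And>a c. functional (\<lambda>b. F a b c)"
    "\<And>a b. functional (\<lambda>c. F a b c)"
  shows "(\<Sum>(r1, r2)\<leftarrow>R. \<Sum>(x, y)\<leftarrow>\<Delta> r2. F r1 x y)
    = (\<Sum>(r1, r2)\<leftarrow>R. \<Sum>(r1', r2')\<leftarrow>R. F (r1 * r1') r2' r2)"
  using tensor3_imp_sum_eq[OF id_comult_R assms] by (simp only: sum_list_comprehension prod.case)

lemma ex_R_inverse:
  "\<exists>Q. (\<forall>F. bilinear_form F \<longrightarrow> (\<Sum>(r1, r2)\<leftarrow>R. \<Sum>(q1, q2)\<leftarrow>Q. F (r1 * q1) (r2 * q2)) = F 1 1) \<and>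
       (\<forall>F. bilinear_form F \<longrightarrow> (\<Sum>(q1, q2)\<leftarrow>Q. \<Sum>(r1, r2)\<leftarrow>R. F (q1 * r1) (q2 * r2)) = F 1 1)"
proof -
  obtain Q where
    1: "tensor2 s s [(r1 * q1, r2 * q2). (r1, r2)\<leftarrow>R, (q1, q2)\<leftarrow>Q] [(1, 1)]" and
    2: "tensor2 s s [(q1 * r1, q2 * r2). (q1, q2)\<leftarrow>Q, (r1, r2)\<leftarrow>R] [(1, 1)]"
    using R_invertible by blast
  have one: "(\<Sum>(x, y)\<leftarrow>[(1, 1)]. F x y) = F 1 1" for F :: "'h \<Rightarrow> 'h \<Rightarrow> 'k" by simp
  show ?thesis
    using tensor2_imp_sum_eq[OF 1] tensor2_imp_sum_eq[OF 2]
    unfolding sum_list_comprehension one by blast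
qed

text \<open>
  \<open>(\<epsilon> \<otimes> id)R = 1\<close>: applying \<open>\<epsilon> \<otimes> id \<otimes> id\<close> to \<open>(\<Delta> \<otimes> id)R = R\<^sup>1\<^sup>3 R\<^sup>2\<^sup>3\<close> gives \<open>R = (1 \<otimes> e) R\<close> with
  \<open>e = (\<epsilon> \<otimes> id)R\<close>. Multiplying by the inverse of \<open>R\<close>, which enters through the form \<open>?G\<close>, yields
  \<open>e = 1\<close>.
\<close>

lemma counit_R_left:
  assumes f: "functional f"
  shows "(\<Sum>(r1, r2)\<leftarrow>R. \<epsilon> r1 * f r2) = f 1"
proof -
  obtain Q where Q: "\<And>F. bilinear_form F \<Longrightarrow>
      (\<Sum>(r1, r2)\<leftarrow>R. \<Sum>(q1, q2)\<leftarrow>Q. F (r1 * q1) (r2 * q2)) = F 1 1"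
    using ex_R_inverse by blast
  note linear = bilinear_formI functional_comp[OF f] linear_rules
  let ?G = "\<lambda>x y. \<Sum>(q1, q2)\<leftarrow>Q. \<epsilon> (x * q1) * f (y * q2)"
  have "f 1 = (\<Sum>(r1, r2)\<leftarrow>R. ?G r1 r2)"
    using Q[of "\<lambda>x y. \<epsilon> x * f y"] by (simp add: linear counit_one)
  also have "\<dots> = (\<Sum>(r1, r2)\<leftarrow>R. \<Sum>(x, y)\<leftarrow>\<Delta> r1. \<epsilon> x * ?G y r2)"
    by (intro sum_list_pair_cong counit_left_sum[symmetric] linear)
  also have "\<dots> = (\<Sum>(r1, r2)\<leftarrow>R. \<Sum>(r1', r2')\<leftarrow>R. \<epsilon> r1 * ?G r1' (r2 * r2'))"
    by (intro comult_id_R_sum linear)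
  also have "\<dots> = (\<Sum>(r1, r2)\<leftarrow>R. \<epsilon> r1 * f r2)"
  proof (intro sum_list_pair_cong)
    fix r1 r2
    have "(\<Sum>(r1', r2')\<leftarrow>R. \<epsilon> r1 * ?G r1' (r2 * r2')) = \<epsilon> r1 * (\<Sum>(r1', r2')\<leftarrow>R. ?G r1' (r2 * r2'))"
      by (rule sum_list_pair_mult)
    also have "(\<Sum>(r1', r2')\<leftarrow>R. ?G r1' (r2 * r2')) = f r2"
      using Q[of "\<lambda>x y. \<epsilon> x * f (r2 * y)"] by (simp add: linear counit_one mult.assoc)
    finally show "(\<Sum>(r1', r2')\<leftarrow>R. \<epsilon> r1 * ?G r1' (r2 * r2')) = \<epsilon> r1 * f r2" .
  qed
  finally show ?thesis by simp
qed

text \<open>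
  \<open>(id \<otimes> \<epsilon>)R = 1\<close>, by the argument of \<open>counit_R_left\<close> applied to \<open>(id \<otimes> \<Delta>)R = R\<^sup>1\<^sup>3 R\<^sup>1\<^sup>2\<close>.
\<close>

lemma counit_R_right:
  assumes f: "functional f"
  shows "(\<Sum>(r1, r2)\<leftarrow>R. \<epsilon> r2 * f r1) = f 1"
proof -
  obtain Q where Q: "\<And>F. bilinear_form F \<Longrightarrow>
      (\<Sum>(r1, r2)\<leftarrow>R. \<Sum>(q1, q2)\<leftarrow>Q. F (r1 * q1) (r2 * q2)) = F 1 1"
    using ex_R_inverse by blast
  note linear = bilinear_formI functional_comp[OF f] linear_rules
  let ?G = "\<lambda>x y. \<Sum>(q1, q2)\<leftarrow>Q. \<epsilon> (y * q2) * f (x * q1)"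
  have "f 1 = (\<Sum>(r1, r2)\<leftarrow>R. ?G r1 r2)"
    using Q[of "\<lambda>x y. \<epsilon> y * f x"] by (simp add: linear counit_one)
  also have "\<dots> = (\<Sum>(r1, r2)\<leftarrow>R. \<Sum>(x, y)\<leftarrow>\<Delta> r2. \<epsilon> y * ?G r1 x)"
    by (intro sum_list_pair_cong counit_right_sum[symmetric] linear)
  also have "\<dots> = (\<Sum>(r1, r2)\<leftarrow>R. \<Sum>(r1', r2')\<leftarrow>R. \<epsilon> r2 * ?G (r1 * r1') r2')"
    by (intro id_comult_R_sum linear)
  also have "\<dots> = (\<Sum>(r1, r2)\<leftarrow>R. \<epsilon> r2 * f r1)"
  proof (intro sum_list_pair_cong)
    fix r1 r2
    have "(\<Sum>(r1', r2')\<leftarrow>R. \<epsilon> r2 * ?G (r1 * r1') r2') = \<epsilon> r2 * (\<Sum>(r1', r2')\<leftarrow>R. ?G (r1 * r1') r2')"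
      by (rule sum_list_pair_mult)
    also have "(\<Sum>(r1', r2')\<leftarrow>R. ?G (r1 * r1') r2') = f r1"
      using Q[of "\<lambda>x y. \<epsilon> y * f (r1 * x)"] by (simp add: linear counit_one mult.assoc)
    finally show "(\<Sum>(r1', r2')\<leftarrow>R. \<epsilon> r2 * ?G (r1 * r1') r2') = \<epsilon> r2 * f r1" .
  qed
  finally show ?thesis by simp
qed

text \<open>
  \<open>(S \<otimes> id)R\<close> is a left inverse of \<open>R\<close>: contract \<open>S(x) y\<close> in the first two legs of \<open>(\<Delta> \<otimes> id)R\<close>.
\<close>

lemma antipode_R_mult_R:
  assumes F: "bilinear_form F"
  shows "(\<Sum>(r1, r2)\<leftarrow>R. \<Sum>(r1', r2')\<leftarrow>R. F (S r1 * r1') (r2 * r2')) = F 1 1"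
proof -
  note linear = bilinear_formI bilinear_left[OF F] bilinear_right[OF F] linear_rules
  have "(\<Sum>(r1, r2)\<leftarrow>R. \<Sum>(r1', r2')\<leftarrow>R. F (S r1 * r1') (r2 * r2'))
      = (\<Sum>(r1, r2)\<leftarrow>R. \<Sum>(x, y)\<leftarrow>\<Delta> r1. F (S x * y) r2)"
    by (intro comult_id_R_sum[symmetric] linear)
  also have "\<dots> = (\<Sum>(r1, r2)\<leftarrow>R. \<epsilon> r1 * F 1 r2)"
    by (intro sum_list_pair_cong antipode_left_sum linear)
  also have "\<dots> = F 1 1"
    by (intro counit_R_left linear)
  finally show ?thesis .
qed

text \<open>
  \<open>(S \<otimes> S)R\<close> is a left inverse of \<open>(S \<otimes> id)R\<close>: contract \<open>S(x) y\<close> in the last two legs of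
  \<open>(S \<otimes> \<Delta>)R\<close>.
\<close>

lemma antipode_R_mult_antipode_R:
  assumes F: "bilinear_form F"
  shows "(\<Sum>(r1, r2)\<leftarrow>R. \<Sum>(r1', r2')\<leftarrow>R. F (S r1' * S r1) (S r2' * r2)) = F 1 1"
proof -
  note linear = bilinear_formI bilinear_left[OF F] bilinear_right[OF F] linear_rules
  have "(\<Sum>(r1, r2)\<leftarrow>R. \<Sum>(r1', r2')\<leftarrow>R. F (S r1' * S r1) (S r2' * r2))
      = (\<Sum>(r1, r2)\<leftarrow>R. \<Sum>(r1', r2')\<leftarrow>R. F (S (r1 * r1')) (S r2' * r2))"
    by (simp only: antipode_mult)
  also have "\<dots> = (\<Sum>(r1, r2)\<leftarrow>R. \<Sum>(x, y)\<leftarrow>\<Delta> r2. F (S r1) (S x * y))"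
    by (intro id_comult_R_sum[symmetric] linear)
  also have "\<dots> = (\<Sum>(r1, r2)\<leftarrow>R. \<epsilon> r2 * F (S r1) 1)"
    by (intro sum_list_pair_cong antipode_left_sum linear)
  also have "\<dots> = F (S 1) 1"
    by (intro counit_R_right linear)
  finally show ?thesis by (simp add: antipode_one)
qed

text \<open>
  The element \<open>(S \<otimes> id)R\<close> has the left inverse \<open>(S \<otimes> S)R\<close> and the right inverse \<open>R\<close>, which
  therefore agree; both cancellations are read off from the product of the three elements.
\<close>

lemma antipode_antipode_R:
  assumes F: "bilinear_form F"
  shows "(\<Sum>(r1, r2)\<leftarrow>R. F (S r1) (S r2)) = (\<Sum>(r1, r2)\<leftarrow>R. F r1 r2)"
proof -
  note linear = bilinear_formI bilinear_left[OF F] bilinear_right[OF F] linear_rules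
  have "(\<Sum>(a1, a2)\<leftarrow>R. F (S a1) (S a2))
      = (\<Sum>(a1, a2)\<leftarrow>R. \<Sum>(b1, b2)\<leftarrow>R. \<Sum>(c1, c2)\<leftarrow>R. F (S a1 * (S b1 * c1)) (S a2 * (b2 * c2)))"
  proof (intro sum_list_pair_cong)
    fix a1 a2
    show "F (S a1) (S a2)
      = (\<Sum>(b1, b2)\<leftarrow>R. \<Sum>(c1, c2)\<leftarrow>R. F (S a1 * (S b1 * c1)) (S a2 * (b2 * c2)))"
      using antipode_R_mult_R[of "\<lambda>x y. F (S a1 * x) (S a2 * y)"] by (simp add: linear)
  qed
  also have "\<dots> = (\<Sum>(b1, b2)\<leftarrow>R. \<Sum>(a1, a2)\<leftarrow>R. \<Sum>(c1, c2)\<leftarrow>R. F (S a1 * (S b1 * c1)) (S a2 * (b2 * c2)))"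
    by (rule sum_list_pair_swap)
  also have "\<dots> = (\<Sum>(b1, b2)\<leftarrow>R. \<Sum>(a1, a2)\<leftarrow>R.
      \<Sum>(c1, c2)\<leftarrow>R. F ((S a1 * S b1) * c1) ((S a2 * b2) * c2))"
    by (simp only: mult.assoc)
  also have "\<dots> = (\<Sum>(c1, c2)\<leftarrow>R. F (1 * c1) (1 * c2))"
    by (intro antipode_R_mult_antipode_R linear)
  finally show ?thesis by simp
qed

section \<open>The transmuted coproduct\<close>

lemma transmuted_comult_sum:
  "(\<Sum>(x, y)\<leftarrow>transmuted_comult \<Delta> S R h. F x y)
    = (\<Sum>(h1, h2)\<leftarrow>\<Delta> h. \<Sum>(r1, r2)\<leftarrow>R. F (h1 * S r2) (adjoint \<Delta> S r1 h2))"
  unfolding transmuted_comult_def by (simp only: sum_list_comprehension)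

text \<open>
  The formula \<open>\<Delta>\<^sub>R(h) = R\<^sup>2 \<cdot> h\<^sub>2 \<otimes> R\<^sup>1 h\<^sub>1\<close>, which puts the adjoint action into the first leg. With a second
  copy \<open>T\<close> of \<open>R\<close>, the coproduct of \<open>R\<^sup>1\<close> is resolved into
  \<open>h\<^sub>1 S(T\<^sup>2) S(R\<^sup>2) \<otimes> R\<^sup>1 h\<^sub>2 S(T\<^sup>1)\<close>. Here \<open>(S \<otimes> S)T = T\<close> removes two antipodes, quasi-cocommutativity
  moves \<open>T\<close> to the other side of \<open>h\<close> and at the same time exchanges \<open>h\<^sub>1\<close> and \<open>h\<^sub>2\<close>, and in the
  resulting \<open>T\<^sup>2 h\<^sub>2 S(R\<^sup>2) \<otimes> R\<^sup>1 T\<^sup>1 h\<^sub>1\<close> the two copies combine to the coproduct of \<open>R\<^sup>2\<close>.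
\<close>

lemma transmuted_comult_flip_sum:
  assumes F: "bilinear_form F"
  shows "(\<Sum>(x, y)\<leftarrow>transmuted_comult \<Delta> S R h. F x y)
    = (\<Sum>(h1, h2)\<leftarrow>\<Delta> h. \<Sum>(r1, r2)\<leftarrow>R. F (adjoint \<Delta> S r2 h2) (r1 * h1))"
proof -
  note linear = bilinear_formI bilinear_left[OF F] bilinear_right[OF F] linear_rules
  have "(\<Sum>(x, y)\<leftarrow>transmuted_comult \<Delta> S R h. F x y)
      = (\<Sum>(h1, h2)\<leftarrow>\<Delta> h. \<Sum>(r1, r2)\<leftarrow>R. \<Sum>(x, y)\<leftarrow>\<Delta> r1. F (h1 * S r2) (x * h2 * S y))"
    unfolding transmuted_comult_sum by (intro sum_list_pair_cong functional_adjoint linear)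
  also have "\<dots> = (\<Sum>(h1, h2)\<leftarrow>\<Delta> h. \<Sum>(r1, r2)\<leftarrow>R. \<Sum>(t1, t2)\<leftarrow>R.
      F (h1 * S (r2 * t2)) (r1 * h2 * S t1))"
    by (intro sum_list_pair_cong comult_id_R_sum linear)
  also have "\<dots> = (\<Sum>(h1, h2)\<leftarrow>\<Delta> h. \<Sum>(r1, r2)\<leftarrow>R. \<Sum>(t1, t2)\<leftarrow>R.
      F (h1 * (S t2 * S r2)) (r1 * h2 * S t1))"
    by (simp only: antipode_mult)
  also have "\<dots> = (\<Sum>(h1, h2)\<leftarrow>\<Delta> h. \<Sum>(r1, r2)\<leftarrow>R. \<Sum>(t1, t2)\<leftarrow>R.
      F (h1 * (t2 * S r2)) (r1 * h2 * t1))"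
    by (intro sum_list_pair_cong antipode_antipode_R linear)
  also have "\<dots> = (\<Sum>(r1, r2)\<leftarrow>R. \<Sum>(h1, h2)\<leftarrow>\<Delta> h. \<Sum>(t1, t2)\<leftarrow>R.
      F (h1 * (t2 * S r2)) (r1 * h2 * t1))"
    by (rule sum_list_pair_swap)
  also have "\<dots> = (\<Sum>(r1, r2)\<leftarrow>R. \<Sum>(t1, t2)\<leftarrow>R. \<Sum>(h1, h2)\<leftarrow>\<Delta> h.
      F (h1 * (t2 * S r2)) (r1 * h2 * t1))"
    by (intro sum_list_pair_cong sum_list_pair_swap)
  also have "\<dots> = (\<Sum>(r1, r2)\<leftarrow>R. \<Sum>(t1, t2)\<leftarrow>R. \<Sum>(h1, h2)\<leftarrow>\<Delta> h.
      F (t2 * h2 * S r2) (r1 * t1 * h1))"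
  proof (rule sum_list_pair_cong)
    fix r1 r2
    show "(\<Sum>(t1, t2)\<leftarrow>R. \<Sum>(h1, h2)\<leftarrow>\<Delta> h. F (h1 * (t2 * S r2)) (r1 * h2 * t1))
        = (\<Sum>(t1, t2)\<leftarrow>R. \<Sum>(h1, h2)\<leftarrow>\<Delta> h. F (t2 * h2 * S r2) (r1 * t1 * h1))"
      using R_comult_sum[of "\<lambda>u v. F (v * S r2) (r1 * u)" h] by (simp add: linear mult.assoc)
  qed
  also have "\<dots> = (\<Sum>(r1, r2)\<leftarrow>R. \<Sum>(x, y)\<leftarrow>\<Delta> r2. \<Sum>(h1, h2)\<leftarrow>\<Delta> h.
      F (x * h2 * S y) (r1 * h1))"
    by (intro id_comult_R_sum[symmetric] linear)
  also have "\<dots> = (\<Sum>(r1, r2)\<leftarrow>R. \<Sum>(h1, h2)\<leftarrow>\<Delta> h. \<Sum>(x, y)\<leftarrow>\<Delta> r2.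
      F (x * h2 * S y) (r1 * h1))"
    by (intro sum_list_pair_cong sum_list_pair_swap)
  also have "\<dots> = (\<Sum>(r1, r2)\<leftarrow>R. \<Sum>(h1, h2)\<leftarrow>\<Delta> h. F (adjoint \<Delta> S r2 h2) (r1 * h1))"
    by (intro sum_list_pair_cong functional_adjoint[symmetric] linear)
  also have "\<dots> = (\<Sum>(h1, h2)\<leftarrow>\<Delta> h. \<Sum>(r1, r2)\<leftarrow>R. F (adjoint \<Delta> S r2 h2) (r1 * h1))"
    by (rule sum_list_pair_swap)
  finally show ?thesis .
qed

text \<open>
  One leg of \<open>\<Delta>\<^sub>R\<close> lies in \<open>D\<close> by the definition of \<open>\<Delta>\<^sub>R\<close>, the other one by
  \<open>transmuted_comult_flip_sum\<close>: each formula applies the adjoint action to \<open>h\<^sub>2\<close>, the leg of \<open>\<Delta>(h)\<close>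
  that stays in \<open>D\<close>.
\<close>

lemma yd_submodule_imp_subcoalgebra:
  assumes "yd_submodule s s (adjoint \<Delta> S) \<Delta> D"
  shows "subcoalgebra s (transmuted_comult \<Delta> S R) D"
  unfolding subcoalgebra_def
proof (intro conjI ballI)
  show D: "subspace D" using assms by (simp add: yd_submodule_def)
  have stable: "adjoint \<Delta> S h a \<in> D" if "a \<in> D" for h a
    using assms that by (simp add: yd_submodule_def action_stable_def)
  fix d assume "d \<in> D"
  then obtain ys where ys: "set ys \<subseteq> UNIV \<times> D" "tensor2 s s (\<Delta> d) ys"
    using assms by (auto simp: yd_submodule_def in_tensor_def)
  have "tensor2 s s (transmuted_comult \<Delta> S R d)
      [(a * S r2, adjoint \<Delta> S r1 b). (a, b)\<leftarrow>ys, (r1, r2)\<leftarrow>R]"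
  proof (rule tensor2I)
    fix F assume F: "bilinear_form F"
    note linear = bilinear_formI bilinear_left[OF F] bilinear_right[OF F] linear_rules
    show "(\<Sum>(x, y)\<leftarrow>transmuted_comult \<Delta> S R d. F x y)
      = (\<Sum>(x, y)\<leftarrow>[(a * S r2, adjoint \<Delta> S r1 b). (a, b)\<leftarrow>ys, (r1, r2)\<leftarrow>R]. F x y)"
      unfolding transmuted_comult_sum sum_list_pair_concat sum_list_pair_map
      by (rule tensor2_imp_sum_eq[OF ys(2)]) (intro linear)
  qed
  moreover have "set [(a * S r2, adjoint \<Delta> S r1 b). (a, b)\<leftarrow>ys, (r1, r2)\<leftarrow>R] \<subseteq> UNIV \<times> D"
    using ys(1) stable by auto
  ultimately have right: "in_tensor s s UNIV D (transmuted_comult \<Delta> S R d)"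
    unfolding in_tensor_def by blast
  have "tensor2 s s (transmuted_comult \<Delta> S R d)
      [(adjoint \<Delta> S r2 b, r1 * a). (a, b)\<leftarrow>ys, (r1, r2)\<leftarrow>R]"
  proof (rule tensor2I)
    fix F assume F: "bilinear_form F"
    note linear = bilinear_formI bilinear_left[OF F] bilinear_right[OF F] linear_rules
    show "(\<Sum>(x, y)\<leftarrow>transmuted_comult \<Delta> S R d. F x y)
      = (\<Sum>(x, y)\<leftarrow>[(adjoint \<Delta> S r2 b, r1 * a). (a, b)\<leftarrow>ys, (r1, r2)\<leftarrow>R]. F x y)"
      unfolding transmuted_comult_flip_sum[OF F] sum_list_pair_concat sum_list_pair_map
      by (rule tensor2_imp_sum_eq[OF ys(2)]) (intro linear)
  qed
  moreover have "set [(adjoint \<Delta> S r2 b, r1 * a). (a, b)\<leftarrow>ys, (r1, r2)\<leftarrow>R] \<subseteq> D \<times> UNIV"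
    using ys(1) stable by auto
  ultimately have left: "in_tensor s s D UNIV (transmuted_comult \<Delta> S R d)"
    unfolding in_tensor_def by blast
  show "in_tensor s s D D (transmuted_comult \<Delta> S R d)"
    by (rule in_tensor_Int[OF D D left right])
qed

text \<open>
  The map \<open>a \<otimes> b \<mapsto> a S(Q\<^sup>2) \<otimes> Q\<^sup>1 \<cdot> b\<close> with \<open>Q = R\<^sup>-\<^sup>1\<close> recovers \<open>\<Delta>\<close> from \<open>\<Delta>\<^sub>R\<close>, and it keeps the second
  leg in \<open>E\<close> by stability.
\<close>

lemma subcoalgebra_imp_yd_submodule:
  assumes stable: "action_stable (adjoint \<Delta> S) E"
    and E: "subcoalgebra s (transmuted_comult \<Delta> S R) E"
  shows "yd_submodule s s (adjoint \<Delta> S) \<Delta> E"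
  unfolding yd_submodule_def
proof (intro conjI ballI)
  show "subspace E" "action_stable (adjoint \<Delta> S) E"
    using assms by (simp_all add: subcoalgebra_def)
  obtain Q where Q: "\<And>F. bilinear_form F \<Longrightarrow>
      (\<Sum>(q1, q2)\<leftarrow>Q. \<Sum>(r1, r2)\<leftarrow>R. F (q1 * r1) (q2 * r2)) = F 1 1"
    using ex_R_inverse by blast
  fix e assume "e \<in> E"
  then obtain ys where ys: "set ys \<subseteq> E \<times> E" "tensor2 s s (transmuted_comult \<Delta> S R e) ys"
    using E by (auto simp: subcoalgebra_def in_tensor_def)
  have "tensor2 s s (\<Delta> e) [(a * S q2, adjoint \<Delta> S q1 b). (a, b)\<leftarrow>ys, (q1, q2)\<leftarrow>Q]"
  proof (rule tensor2I)
    fix F assume F: "bilinear_form F"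
    note linear = bilinear_formI bilinear_left[OF F] bilinear_right[OF F] linear_rules
    let ?G = "\<lambda>a b. \<Sum>(q1, q2)\<leftarrow>Q. F (a * S q2) (adjoint \<Delta> S q1 b)"
    have "(\<Sum>(a, b)\<leftarrow>ys. ?G a b) = (\<Sum>(a, b)\<leftarrow>transmuted_comult \<Delta> S R e. ?G a b)"
      by (rule tensor2_imp_sum_eq[OF ys(2), symmetric]) (intro linear)
    also have "\<dots> = (\<Sum>(h1, h2)\<leftarrow>\<Delta> e. \<Sum>(r1, r2)\<leftarrow>R. ?G (h1 * S r2) (adjoint \<Delta> S r1 h2))"
      by (rule transmuted_comult_sum)
    also have "\<dots> = (\<Sum>(h1, h2)\<leftarrow>\<Delta> e. F h1 h2)"
    proof (intro sum_list_pair_cong)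
      fix h1 h2
      have "(\<Sum>(r1, r2)\<leftarrow>R. ?G (h1 * S r2) (adjoint \<Delta> S r1 h2))
        = (\<Sum>(q1, q2)\<leftarrow>Q. \<Sum>(r1, r2)\<leftarrow>R. F (h1 * S r2 * S q2) (adjoint \<Delta> S q1 (adjoint \<Delta> S r1 h2)))"
        by (rule sum_list_pair_swap)
      also have "\<dots> = (\<Sum>(q1, q2)\<leftarrow>Q. \<Sum>(r1, r2)\<leftarrow>R. F (h1 * S (q2 * r2)) (adjoint \<Delta> S (q1 * r1) h2))"
        by (simp only: antipode_mult adjoint_mult mult.assoc)
      also have "\<dots> = F (h1 * S 1) (adjoint \<Delta> S 1 h2)"
        by (rule Q) (intro linear)
      finally show "(\<Sum>(r1, r2)\<leftarrow>R. ?G (h1 * S r2) (adjoint \<Delta> S r1 h2)) = F h1 h2"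
        by (simp add: antipode_one adjoint_one)
    qed
    finally show "(\<Sum>(x, y)\<leftarrow>\<Delta> e. F x y)
      = (\<Sum>(x, y)\<leftarrow>[(a * S q2, adjoint \<Delta> S q1 b). (a, b)\<leftarrow>ys, (q1, q2)\<leftarrow>Q]. F x y)"
      by (simp only: sum_list_comprehension)
  qed
  moreover have "set [(a * S q2, adjoint \<Delta> S q1 b). (a, b)\<leftarrow>ys, (q1, q2)\<leftarrow>Q] \<subseteq> UNIV \<times> E"
    using ys(1) stable by (auto simp: action_stable_def)
  ultimately show "in_tensor s s UNIV E (\<Delta> e)"
    unfolding in_tensor_def by blast
qed

lemma yd_submodule_iff_stable_subcoalgebra:
  "yd_submodule s s (adjoint \<Delta> S) \<Delta> E \<longleftrightarrow>
    action_stable (adjoint \<Delta> S) E \<and> subcoalgebra s (transmuted_comult \<Delta> S R) E"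
  using yd_submodule_imp_subcoalgebra subcoalgebra_imp_yd_submodule
  by (auto simp: yd_submodule_def)

end

theorem proposition3p1:
  fixes s :: "'k::field \<Rightarrow> 'h::ring_1 \<Rightarrow> 'h"
    and \<Delta> :: "'h \<Rightarrow> ('h \<times> 'h) list"
    and \<epsilon> :: "'h \<Rightarrow> 'k"
    and S :: "'h \<Rightarrow> 'h"
    and R :: "('h \<times> 'h) list"
  assumes "quasitriangular_hopf_algebra s \<Delta> \<epsilon> S R"
  shows "yetter_drinfeld_module s \<Delta> \<epsilon> S s (adjoint \<Delta> S) \<Delta> \<and>
    (\<forall>D. yd_submodule s s (adjoint \<Delta> S) \<Delta> D \<longrightarrow>
           subcoalgebra s (transmuted_comult \<Delta> S R) D) \<and>
    (\<forall>D. minimal_nonzero (yd_submodule s s (adjoint \<Delta> S) \<Delta>) D \<longleftrightarrow>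
           minimal_nonzero
             (\<lambda>E. action_stable (adjoint \<Delta> S) E \<and> subcoalgebra s (transmuted_comult \<Delta> S R) E) D)"
proof -
  interpret quasitriangular_hopf_algebra s \<Delta> \<epsilon> S R by (rule assms)
  show ?thesis
    using adjoint_yetter_drinfeld_module yd_submodule_imp_subcoalgebra
    by (simp add: yd_submodule_iff_stable_subcoalgebra minimal_nonzero_def)
qed

end
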